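(* Let $F\colon X\to Y\cup\{+\infty_Y\}$ and $G\colon X\to Z\cup\{+\infty_Z\}$ be proper mappings, $C\subset X$ nonempty, $A:=C\cap G^{-1}(-S)$, and assume $A\cap\operatorname{dom}F\neq\emptyset$. Let $\mathcal{A}_i$ and $N_i^L$ ($i=1,2,3$, $L\in\mathcal{L}(X,Y)$) be the sets defined in the context. Then for each $i\in\{1,2,3\}$ the following two statements are equivalent: $(\mathbf{a}_i)$ $\operatorname{epi}(F+I_A)^*=\mathcal{A}_i$; $(\mathbf{c}_i)$ stable strong duality holds for the pair $(\mathrm{VP})$–$(\mathrm{VD}_i)$, i.e., for every $L\in\mathcal{L}(X,Y)$, $$\operatorname{WInf}\{F(x)-L(x): x\in C,\ G(x)\in-S\}=\operatorname{WMax}N_i^L .$$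
   Context: **Spaces and order.** $X,Y,Z$ are locally convex Hausdorff topological vector spaces; $K\subset Y$ is a proper ($K\ne Y$) closed convex cone with $\operatorname{int}K\neq\emptyset$; $S\subset Z$ is a nonempty closed convex cone. In $Y$: $y_1<_K y_2$ iff $y_1-y_2\in-\operatorname{int}K$. $Y^\bullet:=Y\cup\{-\infty_Y,+\infty_Y\}$ with $-\infty_Y<_K y<_K+\infty_Y$ for all $y\in Y$ (and $-\infty_Y<_K+\infty_Y$). Conventions: $-(\pm\infty_Y)=\mp\infty_Y$; $(+\infty_Y)+y=+\infty_Y$ for $y\in Y\cup\{+\infty_Y\}$; $(-\infty_Y)+y=-\infty_Y$ for $y\in Y\cup\{-\infty_Y\}$; sums of sets are elementwise. **Weak suprema/infima.** For $M\subset Y^\bullet$, $\operatorname{WSup}M$ is the set of $\bar v\in Y^\bullet$ such that $\bar v\not<_K v$ for all $v\in M$ and, for every $\tilde v\in Y^\bullet$ with $\tilde v<_K\bar v$, there is $v\in M$ with $\tilde v<_K v$. $\operatorname{WInf}M$ is the set of $\bar v\in Y^\bullet$ such that $v\not<_K\bar v$ for all $v\in M$ and, for every $\tilde v\in Y^\bullet$ with $\bar v<_K\tilde v$, there is $v\in M$ with $v<_K\tilde v$. $\operatorname{WMax}M:=M\cap\operatorname{WSup}M$. **Set order and WS-sum.** For nonempty $M,N\subset Y^\bullet$, $M\preccurlyeq_K N$ means $v\not<_K u$ for all $u\in M$, $v\in N$. $\mathcal{P}_p(Y)$ is the collection of all $U\subset Y$ such that $Y=(U-\operatorname{int}K)\cup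 U\cup(U+\operatorname{int}K)$ with the three sets pairwise disjoint. For $U,V\in\mathcal{P}_p(Y)\cup\{\{+\infty_Y\}\}$, $U\uplus V:=\operatorname{WSup}(U+V)$, which again lies in $\mathcal{P}_p(Y)\cup\{\{+\infty_Y\}\}$; $\uplus$ is associative and commutative. **Mappings.** For $H\colon X\to Y\cup\{+\infty_Y\}$, $\operatorname{dom}H=\{x: H(x)\neq+\infty_Y\}$; $H$ is proper if $\operatorname{dom}H\ne\emptyset$ (similarly for $G$). $I_D(x)=0_Y$ if $x\in D$, $+\infty_Y$ otherwise. $\mathcal{L}(X,Y)$ is the space of continuous linear mappings $X\to Y$, and $\mathcal{L}_+(S,K):=\{T\in\mathcal{L}(Z,Y): T(S)\subset K\}$. $(T\circ G)(x):=+\infty_Y$ when $G(x)=+\infty_Z$. **Conjugates and epigraphs.** $H^*(L):=\operatorname{WSup}\{L(x)-H(x): x\in X\}$ for $L\in\mathcal{L}(X,Y)$; $\operatorname{dom}H^*:=\{L: H^*(L)\ne\{+\infty_Y\}\}$; $\operatorname{epi}H^*:=\{(L,y)\in\mathcal{L}(X,Y)\times Y: y\in H^*(L)+K\}$. The extended epigraph is $\mathfrak{E}\mathrm{pi}\,H^*:=\{(L,U)\in\mathcal{L}(X,Y)\times\mathcal{P}_p(Y): L\in\operatorname{dom}H^*,\ H^*(L)\preccurlyeq_K U\}$. For $\mathscr{M}_1,\mathscr{M}_2\subset\mathcal{L}(X,Y)\times\mathcal{P}_p(Y)$, $\mathscr{M}_1\boxplus\mathscr{M}_2:=\{(L_1+L_2,U_1\uplus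 U_2):(L_i,U_i)\in\mathscr{M}_i,\ U_1\uplus U_2\in\mathcal{P}_p(Y)\}$ (pairs with $U_1\uplus U_2=\{+\infty_Y\}$ are discarded); this operation is commutative and associative. For $\mathscr{M}\subset\mathcal{L}(X,Y)\times\mathcal{P}_p(Y)$, $\Psi(\mathscr{M}):=\bigcup_{(L,U)\in\mathscr{M}}\{L\}\times U\subset\mathcal{L}(X,Y)\times Y$. **The sets $\mathcal{A}_i$.** $$\mathcal{A}_1:=\Psi\Big(\bigcup_{T\in\mathcal{L}_+(S,K)}\mathfrak{E}\mathrm{pi}(F+I_C+T\circ G)^*\Big),$$ $$\mathcal{A}_2:=\Psi\Big(\mathfrak{E}\mathrm{pi}F^*\boxplus\bigcup_{T\in\mathcal{L}_+(S,K)}\mathfrak{E}\mathrm{pi}(I_C+T\circ G)^*\Big),$$ $$\mathcal{A}_3:=\Psi\Big(\mathfrak{E}\mathrm{pi}F^*\boxplus\mathfrak{E}\mathrm{pi}I_C^*\boxplus\bigcup_{T\in\mathcal{L}_+(S,K)}\mathfrak{E}\mathrm{pi}(T\circ G)^*\Big).$$ **Problems.** $(\mathrm{VP})$ is $\operatorname{WInf}\{F(x):x\in C,\ G(x)\in-S\}$; $(\mathrm{VP}^L)$ is the same problem with $F$ replaced by $F-L$. The duals of $(\mathrm{VP}^L)$ are $(\mathrm{VD}_i^L)$: $\operatorname{WSup}N_i^L$ ($(\mathrm{VD}_i)$ being the case $L=0$), where $$N_1^L:=\bigcup_{T\in\mathcal{L}_+(S,K)}\operatorname{WInf}\{F(x)-L(x)+(T\circ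 G)(x):x\in C\}=\bigcup_{T\in\mathcal{L}_+(S,K)}-(F-L+I_C+T\circ G)^*(0),$$ $$N_2^L:=\bigcup_{L'\in\mathcal{L}(X,Y),\,T\in\mathcal{L}_+(S,K)}-\big[(F-L)^*(L')\uplus(I_C+T\circ G)^*(-L')\big],$$ $$N_3^L:=\bigcup_{L',L''\in\mathcal{L}(X,Y),\,T\in\mathcal{L}_+(S,K)}-\big[(F-L)^*(L')\uplus I_C^*(L'')\uplus(T\circ G)^*(-L'-L'')\big].$$ *)

theory Defs
  imports "HOL-Analysis.Analysis" "HOL-Library.Extended"
begin

section \<open>Locally convex Hausdorff topological vector spaces over the reals\<close>

text \<open>
  The last axiom asks for a neighbourhood base of convex sets at the origin, with \<open>convex V\<close>
  unfolded: that constant has sort \<open>real_vector\<close> and cannot occur in the class specification.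
\<close>

class locally_convex_space = real_vector + topological_ab_group_add + t2_space +
  assumes tendsto_scaleR_Pair:
    "LIM p (nhds c \<times>\<^sub>F nhds x). fst p *\<^sub>R snd p :> nhds (c *\<^sub>R x)"
  and locally_convex_unfolded:
    "open U \<Longrightarrow> 0 \<in> U \<Longrightarrow> \<exists>V. open V \<and>
       (\<forall>x\<in>V. \<forall>y\<in>V. \<forall>u\<ge>0. \<forall>v\<ge>0. u + v = 1 \<longrightarrow> u *\<^sub>R x + v *\<^sub>R y \<in> V) \<and> 0 \<in> V \<and> V \<subseteq> U"

lemma locally_convex:
  fixes U :: "'a::locally_convex_space set"
  assumes "open U" "0 \<in> U"
  shows "\<exists>V. open V \<and> convex V \<and> 0 \<in> V \<and> V \<subseteq> U"
  using locally_convex_unfolded[OF assms] by (simp add: convex_def)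

instance real_normed_vector \<subseteq> locally_convex_space
proof
  fix c :: real and x :: 'a
  show "LIM p (nhds c \<times>\<^sub>F nhds x). fst p *\<^sub>R snd p :> nhds (c *\<^sub>R x)"
    unfolding nhds_prod[symmetric]
    using tendsto_fst[OF filterlim_ident, of "(c, x)"] tendsto_snd[OF filterlim_ident, of "(c, x)"]
    by (auto intro: tendsto_scaleR)
next
  fix U :: "'a set" assume "open U" "0 \<in> U"
  then obtain e where "e > 0" "ball 0 e \<subseteq> U"
    using open_contains_ball by blast
  then have "open (ball (0::'a) e) \<and> convex (ball (0::'a) e) \<and> 0 \<in> ball (0::'a) e \<and> ball 0 e \<subseteq> U"
    by auto
  then show "\<exists>V. open V \<and>
      (\<forall>x\<in>V. \<forall>y\<in>V. \<forall>u\<ge>0. \<forall>v\<ge>0. u + v = 1 \<longrightarrow> u *\<^sub>R x + v *\<^sub>R y \<in> V) \<and> 0 \<in> V \<and> V \<subseteq> U"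
    unfolding convex_def by blast
qed

text \<open>The space of continuous linear mappings, as a set of functions.\<close>

definition clin :: "('a::locally_convex_space \<Rightarrow> 'b::locally_convex_space) set" where
  "clin = {L. linear L \<and> continuous_on UNIV L}"

section \<open>The extended space, weak suprema and weak infima\<close>

text \<open>
  The extended space of \<open>'y\<close> is \<open>'y extended\<close> with \<open>Pinf\<close> and \<open>Minf\<close> for the two infinities.
  The library addition agrees with the usual conventions; it also assigns a value to
  \<open>Pinf + Minf\<close>, a sum that never occurs below for proper mappings.  The library order on
  \<open>extended\<close> is not used; the cone order is \<open>lessK\<close>.
  Elementwise sums of sets are those of the library theory \<open>Set_Algebras\<close>.
\<close>

fun lessK :: "'y::locally_convex_space set \<Rightarrow> 'y extended \<Rightarrow> 'y extended \<Rightarrow> bool" where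
  "lessK K (Fin y1) (Fin y2) \<longleftrightarrow> y1 - y2 \<in> uminus ` interior K"
| "lessK K (Fin y) Pinf \<longleftrightarrow> True"
| "lessK K Minf (Fin y) \<longleftrightarrow> True"
| "lessK K Minf Pinf \<longleftrightarrow> True"
| "lessK K Pinf v \<longleftrightarrow> False"
| "lessK K u Minf \<longleftrightarrow> False"

definition WSup :: "'y::locally_convex_space set \<Rightarrow> 'y extended set \<Rightarrow> 'y extended set" where
  "WSup K M = {w. (\<forall>v\<in>M. \<not> lessK K w v) \<and> (\<forall>u. lessK K u w \<longrightarrow> (\<exists>v\<in>M. lessK K u v))}"

definition WInf :: "'y::locally_convex_space set \<Rightarrow> 'y extended set \<Rightarrow> 'y extended set" where
  "WInf K M = {w. (\<forall>v\<in>M. \<not> lessK K v w) \<and> (\<forall>u. lessK K w u \<longrightarrow> (\<exists>v\<in>M. lessK K v u))}"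

definition WMax :: "'y::locally_convex_space set \<Rightarrow> 'y extended set \<Rightarrow> 'y extended set" where
  "WMax K M = M \<inter> WSup K M"

definition preceqK :: "'y::locally_convex_space set \<Rightarrow> 'y extended set \<Rightarrow> 'y extended set \<Rightarrow> bool" where
  "preceqK K M N \<longleftrightarrow> (\<forall>u\<in>M. \<forall>v\<in>N. \<not> lessK K v u)"

text \<open>
  The binary minus on sets is set difference, hence \<open>U + uminus ` interior K\<close>
  for the elementwise difference.
\<close>

definition Pp :: "'y::locally_convex_space set \<Rightarrow> 'y set set" where
  "Pp K = {U.
     UNIV = (U + uminus ` interior K) \<union> U \<union> (U + interior K) \<and>
     (U + uminus ` interior K) \<inter> U = {} \<and>
     U \<inter> (U + interior K) = {} \<and>
     (U + uminus ` interior K) \<inter> (U + interior K) = {}}"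

definition wsum :: "'y::locally_convex_space set \<Rightarrow> 'y extended set \<Rightarrow> 'y extended set \<Rightarrow> 'y extended set" where
  "wsum K U V = WSup K (U + V)"

section \<open>Mappings, conjugates and epigraphs\<close>

text \<open>
  A mapping into \<open>'y\<close> with \<open>Pinf\<close> adjoined is a function into \<open>'y extended\<close> that avoids \<open>Minf\<close>.
  The composition \<open>T \<circ> G\<close> of \<open>T :: 'z \<Rightarrow> 'y\<close> with such a mapping \<open>G\<close> is
  \<open>\<lambda>x. map_extended T (G x)\<close>, where \<open>map_extended T\<close> sends \<open>Pinf\<close> to \<open>Pinf\<close>.
\<close>

definition edom :: "('x \<Rightarrow> 'y extended) \<Rightarrow> 'x set" where
  "edom H = {x. H x \<noteq> Pinf}"

definition proper_ext :: "('x \<Rightarrow> 'y extended) \<Rightarrow> bool" where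
  "proper_ext H \<longleftrightarrow> (\<forall>x. H x \<noteq> Minf) \<and> edom H \<noteq> {}"

definition ind :: "'x set \<Rightarrow> 'x \<Rightarrow> 'y::locally_convex_space extended" where
  "ind D x = (if x \<in> D then Fin 0 else Pinf)"

definition Lplus :: "'z::locally_convex_space set \<Rightarrow> 'y::locally_convex_space set \<Rightarrow> ('z \<Rightarrow> 'y) set" where
  "Lplus S K = {T \<in> clin. T ` S \<subseteq> K}"

definition conjugate ::
  "'y::locally_convex_space set \<Rightarrow> ('x::locally_convex_space \<Rightarrow> 'y extended) \<Rightarrow> ('x \<Rightarrow> 'y) \<Rightarrow> 'y extended set" where
  "conjugate K H L = WSup K {Fin (L x) - H x | x. True}"

definition dom_conjugate ::
  "'y::locally_convex_space set \<Rightarrow> ('x::locally_convex_space \<Rightarrow> 'y extended) \<Rightarrow> ('x \<Rightarrow> 'y) set" where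
  "dom_conjugate K H = {L \<in> clin. conjugate K H L \<noteq> {Pinf}}"

definition epi_conjugate ::
  "'y::locally_convex_space set \<Rightarrow> ('x::locally_convex_space \<Rightarrow> 'y extended) \<Rightarrow> (('x \<Rightarrow> 'y) \<times> 'y) set" where
  "epi_conjugate K H = {(L, y). L \<in> clin \<and> Fin y \<in> conjugate K H L + Fin ` K}"

definition Epi_conjugate ::
  "'y::locally_convex_space set \<Rightarrow> ('x::locally_convex_space \<Rightarrow> 'y extended) \<Rightarrow> (('x \<Rightarrow> 'y) \<times> 'y set) set" where
  "Epi_conjugate K H =
     {(L, U). L \<in> dom_conjugate K H \<and> U \<in> Pp K \<and> preceqK K (conjugate K H L) (Fin ` U)}"

text \<open>
  Pairs whose WS-sum is \<open>{Pinf}\<close> are discarded, since \<open>{Pinf}\<close> is not of the form \<open>Fin ` U\<close>.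
\<close>

definition boxplus ::
  "'y::locally_convex_space set \<Rightarrow> (('x \<Rightarrow> 'y) \<times> 'y set) set \<Rightarrow> (('x \<Rightarrow> 'y) \<times> 'y set) set
    \<Rightarrow> (('x \<Rightarrow> 'y) \<times> 'y set) set" where
  "boxplus K M1 M2 =
     {(\<lambda>x. L1 x + L2 x, U) | L1 L2 U1 U2 U.
        (L1, U1) \<in> M1 \<and> (L2, U2) \<in> M2 \<and> U \<in> Pp K \<and> Fin ` U = wsum K (Fin ` U1) (Fin ` U2)}"

definition Psi :: "(('x \<Rightarrow> 'y) \<times> 'y set) set \<Rightarrow> (('x \<Rightarrow> 'y) \<times> 'y) set" where
  "Psi M = (\<Union>(L, U)\<in>M. {L} \<times> U)"

section \<open>The sets on the epigraph side and the dual problems\<close>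

definition feasible ::
  "'z::locally_convex_space set \<Rightarrow> 'x set \<Rightarrow> ('x \<Rightarrow> 'z extended) \<Rightarrow> 'x set" where
  "feasible S C G = C \<inter> G -` (Fin ` uminus ` S)"

definition calA1 ::
  "'y::locally_convex_space set \<Rightarrow> 'z::locally_convex_space set \<Rightarrow> 'x::locally_convex_space set
    \<Rightarrow> ('x \<Rightarrow> 'y extended) \<Rightarrow> ('x \<Rightarrow> 'z extended) \<Rightarrow> (('x \<Rightarrow> 'y) \<times> 'y) set" where
  "calA1 K S C F G =
     Psi (\<Union>T\<in>Lplus S K. Epi_conjugate K (\<lambda>x. F x + ind C x + map_extended T (G x)))"

definition calA2 ::
  "'y::locally_convex_space set \<Rightarrow> 'z::locally_convex_space set \<Rightarrow> 'x::locally_convex_space set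
    \<Rightarrow> ('x \<Rightarrow> 'y extended) \<Rightarrow> ('x \<Rightarrow> 'z extended) \<Rightarrow> (('x \<Rightarrow> 'y) \<times> 'y) set" where
  "calA2 K S C F G =
     Psi (boxplus K (Epi_conjugate K F)
           (\<Union>T\<in>Lplus S K. Epi_conjugate K (\<lambda>x. ind C x + map_extended T (G x))))"

definition calA3 ::
  "'y::locally_convex_space set \<Rightarrow> 'z::locally_convex_space set \<Rightarrow> 'x::locally_convex_space set
    \<Rightarrow> ('x \<Rightarrow> 'y extended) \<Rightarrow> ('x \<Rightarrow> 'z extended) \<Rightarrow> (('x \<Rightarrow> 'y) \<times> 'y) set" where
  "calA3 K S C F G =
     Psi (boxplus K (boxplus K (Epi_conjugate K F) (Epi_conjugate K (ind C)))
           (\<Union>T\<in>Lplus S K. Epi_conjugate K (\<lambda>x. map_extended T (G x))))"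

definition N1 ::
  "'y::locally_convex_space set \<Rightarrow> 'z::locally_convex_space set \<Rightarrow> 'x::locally_convex_space set
    \<Rightarrow> ('x \<Rightarrow> 'y extended) \<Rightarrow> ('x \<Rightarrow> 'z extended) \<Rightarrow> ('x \<Rightarrow> 'y) \<Rightarrow> 'y extended set" where
  "N1 K S C F G L =
     (\<Union>T\<in>Lplus S K. WInf K {F x - Fin (L x) + map_extended T (G x) | x. x \<in> C})"

definition N2 ::
  "'y::locally_convex_space set \<Rightarrow> 'z::locally_convex_space set \<Rightarrow> 'x::locally_convex_space set
    \<Rightarrow> ('x \<Rightarrow> 'y extended) \<Rightarrow> ('x \<Rightarrow> 'z extended) \<Rightarrow> ('x \<Rightarrow> 'y) \<Rightarrow> 'y extended set" where
  "N2 K S C F G L =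
     (\<Union>L'\<in>clin. \<Union>T\<in>Lplus S K.
        uminus ` wsum K
          (conjugate K (\<lambda>x. F x - Fin (L x)) L')
          (conjugate K (\<lambda>x. ind C x + map_extended T (G x)) (\<lambda>x. - L' x)))"

definition N3 ::
  "'y::locally_convex_space set \<Rightarrow> 'z::locally_convex_space set \<Rightarrow> 'x::locally_convex_space set
    \<Rightarrow> ('x \<Rightarrow> 'y extended) \<Rightarrow> ('x \<Rightarrow> 'z extended) \<Rightarrow> ('x \<Rightarrow> 'y) \<Rightarrow> 'y extended set" where
  "N3 K S C F G L =
     (\<Union>L'\<in>clin. \<Union>L''\<in>clin. \<Union>T\<in>Lplus S K.
        uminus ` wsum K
          (wsum K
            (conjugate K (\<lambda>x. F x - Fin (L x)) L')
            (conjugate K (ind C) L''))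
          (conjugate K (\<lambda>x. map_extended T (G x)) (\<lambda>x. - L' x - L'' x)))"

text \<open>
  Stable strong duality for the primal problem and a family of dual problems \<open>WSup K (N L)\<close>,
  one for each linear perturbation \<open>L\<close>: the two values agree and the dual value is attained.
\<close>

definition stable_strong_duality ::
  "'y::locally_convex_space set \<Rightarrow> 'z::locally_convex_space set \<Rightarrow> 'x::locally_convex_space set
    \<Rightarrow> ('x \<Rightarrow> 'y extended) \<Rightarrow> ('x \<Rightarrow> 'z extended) \<Rightarrow> (('x \<Rightarrow> 'y) \<Rightarrow> 'y extended set) \<Rightarrow> bool" where
  "stable_strong_duality K S C F G N \<longleftrightarrow>
     (\<forall>L\<in>clin. WInf K {F x - Fin (L x) | x. x \<in> C \<and> G x \<in> Fin ` uminus ` S} = WMax K (N L))"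

end

theory Submission
  imports Defs
begin

text \<open>
  Weak suprema become manageable once they are traded for the sets strictly below them.  For a
  subset \<open>M\<close> of the extended space, let \<open>D\<close> be the set of points that lie strictly below some
  finite element of \<open>M\<close>.  This \<open>D\<close> is a \<^emph>\<open>lower\<close> set: \<open>D = D - interior K\<close>.  If \<open>M\<close> has a finite element
  and does not contain \<open>Pinf\<close>, then \<open>WSup M\<close> is the frontier of \<open>D\<close>, read as \<open>{Pinf}\<close> when \<open>D\<close> is the
  whole space (\<open>WSup_eq_lower_sup\<close>).  Every line in a direction of \<open>interior K\<close> meets the frontier
  of a nonempty proper lower set (\<open>edge_meets_line\<close>); hence the frontier determines the lower set,
  and the members of \<open>Pp K\<close> are exactly the frontiers of nonempty proper lower sets (\<open>Pp_iff\<close>).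

  Under this correspondence every notion of the theorem becomes elementary.  The WS-sum of two
  frontiers belongs to the sum of the two lower sets (\<open>wsum_lower_sup\<close>), and
  \<open>U \<preccurlyeq> V\<close> becomes inclusion of the lower sets.  With \<open>D\<^sub>H(L)\<close> the lower set of the values
  \<open>L x - H x\<close>, both \<open>epi H\<^sup>*\<close> and \<open>\<Psi>\<close> of the extended epigraph consist of the pairs \<open>(L, y)\<close> with
  \<open>y \<notin> D\<^sub>H(L)\<close>.  Similarly \<open>\<Psi>\<close> of a \<open>boxplus\<close> sum consists of the pairs \<open>(L\<^sub>1 + L\<^sub>2, y)\<close> with
  \<open>y \<notin> D\<^sub>1(L\<^sub>1) + D\<^sub>2(L\<^sub>2)\<close>.  One inclusion is clear; for the other, one summand has to be enlarged
  until \<open>y\<close> lies on the frontier of the sum (\<open>enlarge_summand\<close>).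

  Consequently, for each of the three duals there is a family of lower sets \<open>D\<^sub>j(L)\<close>, indexed by
  the dual variables, such that \<open>\<A>\<close> is the set of all \<open>(L, y)\<close> with \<open>y \<notin> D\<^sub>j(L)\<close> for some \<open>j\<close>, while
  \<open>N\<^sup>L\<close> is the union of the negated frontiers of the \<open>D\<^sub>j(L)\<close>.  With
  \<open>D\<^sub>0(L)\<close> the lower set of \<open>F + I\<^sub>A\<close>, the value of the primal problem is the negated frontier of
  \<open>D\<^sub>0(L)\<close>, and weak duality is the inclusion \<open>D\<^sub>0(L) \<subseteq> D\<^sub>j(L)\<close>.  The equality of epigraphs says that
  \<open>D\<^sub>0(L) = (\<Inter>j. D\<^sub>j(L))\<close> for all \<open>L\<close>.  Strong duality says the same: if \<open>D\<^sub>0\<close> is the intersection,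
  then a frontier point of \<open>D\<^sub>0\<close> is missed by some \<open>D\<^sub>j\<close> and, since \<open>D\<^sub>0 \<subseteq> D\<^sub>j\<close>, lies on the frontier of that
  \<open>D\<^sub>j\<close>; conversely a point outside \<open>D\<^sub>0\<close> dominates a frontier point of \<open>D\<^sub>0\<close>, which attainment puts on
  the frontier of some \<open>D\<^sub>j\<close>, so that the point is outside \<open>D\<^sub>j\<close> (\<open>lower_sup_attained_iff\<close>).
\<close>

section \<open>Solid cones\<close>

lemma open_contains_perturbation:
  fixes x y :: "'a::locally_convex_space"
  assumes "open U" "x \<in> U"
  obtains s :: real where "s > 0" "x - s *\<^sub>R y \<in> U"
proof -
  have "((\<lambda>s::real. (- s, y)) \<longlongrightarrow> (0, y)) (at_right 0)"
    by (auto intro!: tendsto_eq_intros)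
  then have "((\<lambda>s::real. (- s) *\<^sub>R y) \<longlongrightarrow> 0 *\<^sub>R y) (at_right 0)"
    using filterlim_compose[OF tendsto_scaleR_Pair, of "\<lambda>s. (- s, y)" 0 y] by (simp add: nhds_prod)
  then have "((\<lambda>s::real. x + (- s) *\<^sub>R y) \<longlongrightarrow> x + 0) (at_right 0)"
    by (intro tendsto_add tendsto_const) simp
  then have "eventually (\<lambda>s::real. x - s *\<^sub>R y \<in> U) (at_right 0)"
    using assms by (auto dest!: topological_tendstoD)
  moreover have "eventually (\<lambda>s::real. s > 0) (at_right 0)"
    by (rule eventually_at_right_less)
  ultimately have "eventually (\<lambda>s::real. s > 0 \<and> x - s *\<^sub>R y \<in> U) (at_right 0)"
    by (auto elim: eventually_elim2)
  then show thesis
    using that eventually_happens[of _ "at_right (0::real)"] by auto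
qed

lemma continuous_on_scaleR_const:
  "continuous_on UNIV (\<lambda>x::'a::locally_convex_space. c *\<^sub>R x)"
proof (subst continuous_on, intro ballI)
  fix x :: 'a
  have "((\<lambda>x. (c, x)) \<longlongrightarrow> (c, x)) (at x)"
    by (auto intro!: tendsto_eq_intros)
  then show "((\<lambda>x. c *\<^sub>R x) \<longlongrightarrow> c *\<^sub>R x) (at x within UNIV)"
    using filterlim_compose[OF tendsto_scaleR_Pair, of "\<lambda>x. (c, x)" c x] by (simp add: nhds_prod)
qed

locale solid_cone =
  fixes K :: "'y::locally_convex_space set"
  assumes convex_cone: "convex_cone K"
    and not_UNIV: "K \<noteq> UNIV"
    and solid: "interior K \<noteq> {}"
begin

lemma zero_mem: "0 \<in> K"
  using convex_cone by (simp add: convex_cone_iff)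

lemma interior_add:
  assumes "p \<in> interior K" "k \<in> K"
  shows "p + k \<in> interior K"
proof (rule interiorI)
  show "open ((\<lambda>y. y - k) -` interior K)"
    by (intro open_vimage open_interior continuous_intros)
  show "p + k \<in> (\<lambda>y. y - k) -` interior K"
    using assms by simp
  show "(\<lambda>y. y - k) -` interior K \<subseteq> K"
  proof
    fix y assume "y \<in> (\<lambda>y. y - k) -` interior K"
    then have "(y - k) + k \<in> K"
      using assms(2) interior_subset convex_cone_add[OF convex_cone] by blast
    then show "y \<in> K" by simp
  qed
qed

lemma interior_add_interior:
  "p \<in> interior K \<Longrightarrow> q \<in> interior K \<Longrightarrow> p + q \<in> interior K"
  using interior_add interior_subset by blast

lemma interior_scaleR:
  assumes "p \<in> interior K" "c > 0"
  shows "c *\<^sub>R p \<in> interior K"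
proof (rule interiorI)
  show "open ((\<lambda>y. (1/c) *\<^sub>R y) -` interior K)"
    by (intro open_vimage open_interior continuous_on_scaleR_const)
  show "c *\<^sub>R p \<in> (\<lambda>y. (1/c) *\<^sub>R y) -` interior K"
    using assms by simp
  show "(\<lambda>y. (1/c) *\<^sub>R y) -` interior K \<subseteq> K"
  proof
    fix y assume "y \<in> (\<lambda>y. (1/c) *\<^sub>R y) -` interior K"
    then have "c *\<^sub>R ((1/c) *\<^sub>R y) \<in> K"
      using assms(2) interior_subset[of K] convex_cone_scaleR[OF convex_cone, of c] by force
    then show "y \<in> K" using assms(2) by simp
  qed
qed

lemma interior_absorbs:
  assumes "p \<in> interior K"
  obtains s :: real where "s > 0" "p - s *\<^sub>R y \<in> interior K"
  using open_contains_perturbation[OF open_interior assms] by blast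

lemma interior_dominates:
  assumes "p \<in> interior K"
  obtains t :: real where "t > 0" "t *\<^sub>R p - y \<in> interior K"
proof -
  obtain s where s: "s > 0" "p - s *\<^sub>R y \<in> interior K"
    using interior_absorbs[OF assms] by blast
  then have "(1/s) *\<^sub>R (p - s *\<^sub>R y) \<in> interior K"
    by (intro interior_scaleR) auto
  then show thesis
    using s that[of "1/s"] by (simp add: scaleR_diff_right)
qed

lemma zero_notin_interior: "0 \<notin> interior K"
proof
  assume 0: "0 \<in> interior K"
  have "y \<in> K" for y
  proof -
    obtain t where "t > 0" "t *\<^sub>R 0 - (- y) \<in> interior K"
      using interior_dominates[OF 0, of "- y"] by blast
    then show ?thesis using interior_subset by auto
  qed
  then show False using not_UNIV by auto
qed

section \<open>Lower sets and their frontiers\<close>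

text \<open>
  The nonempty sets with \<open>D = D - interior K\<close>.  Being unions of translates of \<open>- interior K\<close>, they
  are open.
\<close>

definition lower :: "'y set \<Rightarrow> bool" where
  "lower D \<longleftrightarrow> D \<noteq> {} \<and> (\<forall>y. y \<in> D \<longleftrightarrow> (\<exists>k\<in>interior K. y + k \<in> D))"

definition down :: "'y set \<Rightarrow> 'y set" where
  "down M = {y. \<exists>m\<in>M. m - y \<in> interior K}"

text \<open>
  The topological frontier of a lower set, described by the order.
\<close>

definition edge :: "'y set \<Rightarrow> 'y set" where
  "edge D = {y. y \<notin> D \<and> (\<forall>k\<in>interior K. y - k \<in> D)}"

lemma lower_below:
  assumes "lower D" "d \<in> D" "d - y \<in> interior K"
  shows "y \<in> D"
proof -
  have "y + (d - y) \<in> D" using assms by simp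
  then show ?thesis using assms unfolding lower_def by blast
qed

lemma lower_below_K:
  assumes "lower D" "d \<in> D" "d - y \<in> K"
  shows "y \<in> D"
proof -
  obtain k where k: "k \<in> interior K" "d + k \<in> D"
    using assms unfolding lower_def by blast
  have "(d + k) - y \<in> interior K"
    using interior_add[OF k(1) assms(3)] by (simp add: algebra_simps)
  then show ?thesis using lower_below assms k by blast
qed

lemma minus_mem_down: "m \<in> M \<Longrightarrow> k \<in> interior K \<Longrightarrow> m - k \<in> down M"
  unfolding down_def by force

lemma lower_down:
  assumes "M \<noteq> {}"
  shows "lower (down M)"
  unfolding lower_def
proof (intro conjI allI iffI)
  obtain m p where "m \<in> M" "p \<in> interior K" using assms solid by blast
  then have "m - p \<in> down M" by (rule minus_mem_down)
  then show "down M \<noteq> {}" by blast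
next
  fix y assume "y \<in> down M"
  then obtain m where m: "m \<in> M" "m - y \<in> interior K" unfolding down_def by blast
  let ?k = "(1/2) *\<^sub>R (m - y)"
  have k: "?k \<in> interior K" using m by (intro interior_scaleR) auto
  have "?k + ?k = m - y" by (simp flip: scaleR_left.add)
  then have "y + ?k = m - ?k" by (simp add: algebra_simps)
  then have "y + ?k \<in> down M" using minus_mem_down[OF m(1) k] by simp
  then show "\<exists>k\<in>interior K. y + k \<in> down M" using k by blast
next
  fix y assume "\<exists>k\<in>interior K. y + k \<in> down M"
  then obtain k m where "k \<in> interior K" "m \<in> M" "m - (y + k) \<in> interior K"
    unfolding down_def by blast
  then show "y \<in> down M"
    using interior_add_interior[of "m - (y + k)" k] unfolding down_def by (auto simp: algebra_simps)
qed

text \<open>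
  The frontier point on the line is found at the supremum of the parameters whose points are in
  \<open>D\<close>.  These parameters exist and are bounded because multiples of an interior direction
  eventually dominate every vector.
\<close>

lemma edge_meets_line:
  assumes D: "lower D" "D \<noteq> UNIV" and e: "e \<in> interior K"
  shows "\<exists>t::real. y + t *\<^sub>R e \<in> edge D"
proof -
  define I where "I = {t::real. y + t *\<^sub>R e \<in> D}"
  obtain d where d: "d \<in> D" using D unfolding lower_def by blast
  obtain z where z: "z \<notin> D" using D by blast
  have eK: "c *\<^sub>R e \<in> K" if "c \<ge> 0" for c
    using that e interior_subset convex_cone_scaleR[OF convex_cone] by blast
  obtain a where a: "a *\<^sub>R e - (y - d) \<in> interior K"
    using interior_dominates[OF e] by blast
  have "y + (- a) *\<^sub>R e \<in> D"
    by (rule lower_below[OF D(1) d]) (use a in \<open>simp add: algebra_simps\<close>)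
  then have ne: "I \<noteq> {}" unfolding I_def by blast
  obtain b where b: "b *\<^sub>R e - (z - y) \<in> interior K"
    using interior_dominates[OF e] by blast
  have "t \<le> b" if "t \<in> I" for t
  proof (rule ccontr)
    assume "\<not> t \<le> b"
    then have "b *\<^sub>R e - (z - y) + (t - b) *\<^sub>R e \<in> interior K"
      using b eK by (intro interior_add) auto
    then have "(y + t *\<^sub>R e) - z \<in> interior K" by (simp add: algebra_simps)
    then show False using z that lower_below[OF D(1)] unfolding I_def by blast
  qed
  then have bdd: "bdd_above I" by (auto simp: bdd_above_def)
  define s where "s = Sup I"
  have "y + s *\<^sub>R e \<notin> D"
  proof
    assume "y + s *\<^sub>R e \<in> D"
    then obtain k where k: "k \<in> interior K" "y + s *\<^sub>R e + k \<in> D"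
      using D(1) unfolding lower_def by blast
    obtain c where c: "c > 0" "k - c *\<^sub>R e \<in> interior K" using interior_absorbs[OF k(1)] by blast
    have "y + (s + c) *\<^sub>R e \<in> D"
      by (rule lower_below[OF D(1) k(2)]) (use c in \<open>simp add: algebra_simps\<close>)
    then have "s + c \<le> s" using cSup_upper[OF _ bdd] unfolding I_def s_def by blast
    then show False using c by simp
  qed
  moreover have "y + s *\<^sub>R e - k \<in> D" if k: "k \<in> interior K" for k
  proof -
    obtain c where c: "c > 0" "k - c *\<^sub>R e \<in> interior K" using interior_absorbs[OF k] by blast
    obtain t where t: "t \<in> I" "s - c < t"
      using less_cSupE[of "s - c" I] c ne unfolding s_def by auto
    have "(k - c *\<^sub>R e) + (t - (s - c)) *\<^sub>R e \<in> interior K"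
      using c t eK by (intro interior_add) auto
    then have "(y + t *\<^sub>R e) - (y + s *\<^sub>R e - k) \<in> interior K" by (simp add: algebra_simps)
    then show ?thesis using t lower_below[OF D(1)] unfolding I_def by blast
  qed
  ultimately show ?thesis unfolding edge_def by blast
qed

lemma edge_above:
  assumes D: "lower D" "D \<noteq> UNIV" and y: "y \<in> D"
  shows "\<exists>u\<in>edge D. u - y \<in> interior K"
proof -
  obtain e where e: "e \<in> interior K" using solid by blast
  obtain t :: real where t: "y + t *\<^sub>R e \<in> edge D" using edge_meets_line[OF D e] by blast
  have "t > 0"
  proof (rule ccontr)
    assume "\<not> t > 0"
    then have "(- t) *\<^sub>R e \<in> K"
      using e interior_subset convex_cone_scaleR[OF convex_cone, of "- t" e] by auto
    then have "y + t *\<^sub>R e \<in> D" using lower_below_K[OF D(1) y] by simp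
    then show False using t unfolding edge_def by blast
  qed
  then have "(y + t *\<^sub>R e) - y \<in> interior K" using interior_scaleR e by simp
  then show ?thesis using t by blast
qed

lemma edge_below:
  assumes D: "lower D" "D \<noteq> UNIV" and y: "y \<notin> D"
  shows "y \<in> edge D \<or> (\<exists>u\<in>edge D. y - u \<in> interior K)"
proof -
  obtain e where e: "e \<in> interior K" using solid by blast
  obtain t :: real where t: "y + t *\<^sub>R e \<in> edge D" using edge_meets_line[OF D e] by blast
  consider "t > 0" | "t = 0" | "t < 0" by linarith
  then show ?thesis
  proof cases
    case 1
    then have "(y + t *\<^sub>R e) - t *\<^sub>R e \<in> D"
      using t interior_scaleR[OF e] unfolding edge_def by blast
    then show ?thesis using y by simp
  next
    case 2
    then show ?thesis using t by simp
  next
    case 3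
    then have "y - (y + t *\<^sub>R e) \<in> interior K" using interior_scaleR[OF e, of "- t"] by simp
    then show ?thesis using t by blast
  qed
qed

lemma edge_below_K:
  assumes "lower D" "D \<noteq> UNIV" "y \<notin> D"
  obtains u where "u \<in> edge D" "y - u \<in> K"
  using edge_below[OF assms] zero_mem interior_subset[of K] by (metis diff_self subsetD)

lemma down_edge:
  assumes "lower D" "D \<noteq> UNIV"
  shows "down (edge D) = D"
proof
  show "down (edge D) \<subseteq> D"
  proof
    fix y assume "y \<in> down (edge D)"
    then obtain u where "u \<in> edge D" "u - y \<in> interior K" unfolding down_def by blast
    then have "u - (u - y) \<in> D" unfolding edge_def by blast
    then show "y \<in> D" by simp
  qed
  show "D \<subseteq> down (edge D)" using edge_above[OF assms] unfolding down_def by blast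
qed

lemma edge_nonempty: "lower D \<Longrightarrow> D \<noteq> UNIV \<Longrightarrow> edge D \<noteq> {}"
  using edge_meets_line solid by blast

lemma minus_interior_eq_down: "U + uminus ` interior K = down U"
proof (intro set_eqI iffI)
  fix y assume "y \<in> U + uminus ` interior K"
  then show "y \<in> down U" by (auto simp: minus_mem_down elim!: set_plus_elim)
next
  fix y assume "y \<in> down U"
  then obtain u where "u \<in> U" "u - y \<in> interior K" unfolding down_def by blast
  then have "u + - (u - y) \<in> U + uminus ` interior K" by (intro set_plus_intro imageI)
  then show "y \<in> U + uminus ` interior K" by simp
qed

lemma mem_plus_interior_iff: "y \<in> U + interior K \<longleftrightarrow> (\<exists>u\<in>U. y - u \<in> interior K)"
proof
  assume "y \<in> U + interior K"
  then show "\<exists>u\<in>U. y - u \<in> interior K" by (force elim!: set_plus_elim)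
next
  assume "\<exists>u\<in>U. y - u \<in> interior K"
  then obtain u where "u \<in> U" "y - u \<in> interior K" by blast
  then have "u + (y - u) \<in> U + interior K" by (intro set_plus_intro)
  then show "y \<in> U + interior K" by simp
qed

text \<open>
  The three sets required by \<open>Pp\<close> are \<open>D\<close>, its frontier, and the part strictly above the frontier.
\<close>

lemma edge_in_Pp:
  assumes D: "lower D" "D \<noteq> UNIV"
  shows "edge D \<in> Pp K"
proof -
  have "y \<in> D \<or> y \<in> edge D \<or> y \<in> edge D + interior K" for y
    using edge_below[OF D] unfolding mem_plus_interior_iff by blast
  moreover have "D \<inter> edge D = {}" unfolding edge_def by blast
  moreover have "y \<notin> edge D + interior K" if "y \<in> D \<or> y \<in> edge D" for y
  proof
    assume "y \<in> edge D + interior K"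
    then obtain u where u: "u \<in> edge D" "y - u \<in> interior K" unfolding mem_plus_interior_iff by blast
    have "u \<in> D"
      using that
    proof
      assume "y \<in> D" then show ?thesis using u lower_below[OF D(1)] by blast
    next
      assume "y \<in> edge D"
      then have "y - (y - u) \<in> D" using u unfolding edge_def by blast
      then show ?thesis by simp
    qed
    then show False using u unfolding edge_def by blast
  qed
  ultimately have "UNIV = D \<union> edge D \<union> (edge D + interior K)"
      "D \<inter> edge D = {}" "edge D \<inter> (edge D + interior K) = {}" "D \<inter> (edge D + interior K) = {}"
    by auto
  then show ?thesis
    unfolding Pp_def mem_Collect_eq minus_interior_eq_down down_edge[OF D] by simp
qed

lemma Pp_iff: "U \<in> Pp K \<longleftrightarrow> (\<exists>D. lower D \<and> D \<noteq> UNIV \<and> U = edge D)"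
proof
  assume U: "U \<in> Pp K"
  have cover: "y \<in> down U \<or> y \<in> U \<or> y \<in> U + interior K" for y
    using U unfolding Pp_def minus_interior_eq_down by blast
  have disj: "down U \<inter> U = {}" "down U \<inter> (U + interior K) = {}"
    using U unfolding Pp_def minus_interior_eq_down by blast+
  have ne: "U \<noteq> {}" using cover[of 0] by (auto simp: down_def mem_plus_interior_iff)
  have "edge (down U) = U"
  proof (intro set_eqI iffI)
    fix y assume y: "y \<in> edge (down U)"
    have "y \<notin> U + interior K"
    proof
      assume "y \<in> U + interior K"
      then obtain u where "u \<in> U" "y - u \<in> interior K" unfolding mem_plus_interior_iff by blast
      then have "u \<in> U" "y - (y - u) \<in> down U" using y unfolding edge_def by blast+
      then show False using disj by auto
    qed
    then show "y \<in> U" using y cover[of y] unfolding edge_def by blast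
  next
    fix y assume "y \<in> U"
    then show "y \<in> edge (down U)" using disj unfolding edge_def by (auto simp: minus_mem_down)
  qed
  moreover have "down U \<noteq> UNIV" using ne disj by blast
  ultimately show "\<exists>D. lower D \<and> D \<noteq> UNIV \<and> U = edge D" 
    using lower_down[OF ne] by (intro exI[of _ "down U"]) simp
next
  assume "\<exists>D. lower D \<and> D \<noteq> UNIV \<and> U = edge D"
  then show "U \<in> Pp K" using edge_in_Pp by blast
qed

lemma lower_plus:
  assumes "lower D" "lower E"
  shows "lower (D + E)"
  unfolding lower_def
proof (intro conjI allI iffI)
  show "D + E \<noteq> {}" using assms unfolding lower_def set_plus_def by blast
next
  fix y assume "y \<in> D + E"
  then obtain d e where de: "y = d + e" "d \<in> D" "e \<in> E" by (auto elim: set_plus_elim)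
  then obtain k where "k \<in> interior K" "e + k \<in> E" using assms(2) unfolding lower_def by blast
  then show "\<exists>k\<in>interior K. y + k \<in> D + E"
    using de set_plus_intro[of d D "e + k" E] by (auto simp: add.assoc)
next
  fix y assume "\<exists>k\<in>interior K. y + k \<in> D + E"
  then obtain k d e where de: "k \<in> interior K" "y + k = d + e" "d \<in> D" "e \<in> E"
    by (auto elim: set_plus_elim)
  then have "e - k \<in> E" using lower_below[OF assms(2), of e "e - k"] by simp
  then show "y \<in> D + E"
    using de set_plus_intro[of d D "e - k" E] by (simp add: algebra_simps flip: de(2))
qed

text \<open>
  A nonempty set plus the whole space is the whole space.
\<close>

lemma summands_not_UNIV:
  assumes "lower D" "lower E" "D + E \<noteq> UNIV"
  shows "D \<noteq> UNIV" "E \<noteq> UNIV"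
proof -
  obtain d e where de: "d \<in> D" "e \<in> E" using assms unfolding lower_def by blast
  have "(y - e) + e \<in> UNIV + E" "d + (y - d) \<in> D + UNIV" for y
    using de by (blast intro: set_plus_intro)+
  then have "UNIV + E = UNIV" "D + UNIV = UNIV" by auto
  then show "D \<noteq> UNIV" "E \<noteq> UNIV" using assms(3) by auto
qed

lemma down_edge_plus_edge:
  assumes D: "lower D" "D \<noteq> UNIV" and E: "lower E" "E \<noteq> UNIV"
  shows "down (edge D + edge E) = D + E"
proof (intro set_eqI iffI)
  fix y assume "y \<in> down (edge D + edge E)"
  then obtain u v where uv: "u \<in> edge D" "v \<in> edge E" "u + v - y \<in> interior K"
    by (auto simp: down_def elim!: set_plus_elim)
  let ?k = "(1/2) *\<^sub>R (u + v - y)"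
  have k: "?k \<in> interior K" using uv by (intro interior_scaleR) auto
  then have "u - ?k \<in> D" "v - ?k \<in> E" using uv unfolding edge_def by blast+
  moreover have "?k + ?k = u + v - y" by (simp flip: scaleR_left.add)
  then have "y = (u - ?k) + (v - ?k)" by (simp add: algebra_simps)
  ultimately show "y \<in> D + E" by (metis set_plus_intro)
next
  fix y assume "y \<in> D + E"
  then obtain d e where de: "y = d + e" "d \<in> D" "e \<in> E" by (auto elim: set_plus_elim)
  obtain u v where uv: "u \<in> edge D" "u - d \<in> interior K" "v \<in> edge E" "v - e \<in> interior K"
    using edge_above[OF D] edge_above[OF E] de by meson
  then have "u + v \<in> edge D + edge E" "u + v - y \<in> interior K"
    using interior_add_interior[of "u - d" "v - e"] de
    by (auto intro: set_plus_intro simp: algebra_simps)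
  then show "y \<in> down (edge D + edge E)" unfolding down_def by blast
qed

lemma lower_Un: "lower D \<Longrightarrow> lower E \<Longrightarrow> lower (D \<union> E)"
  unfolding lower_def by blast

section \<open>Weak suprema as frontiers of lower sets\<close>

lemma lessK_Fin: "lessK K (Fin a) (Fin b) \<longleftrightarrow> b - a \<in> interior K"
proof
  assume "lessK K (Fin a) (Fin b)"
  then obtain k where "k \<in> interior K" "a - b = - k" by auto
  then show "b - a \<in> interior K" by (metis minus_diff_eq minus_minus)
next
  assume "b - a \<in> interior K"
  then have "- (b - a) \<in> uminus ` interior K" by blast
  then show "lessK K (Fin a) (Fin b)" by simp
qed

lemma lessK_uminus: "lessK K (- u) (- v) \<longleftrightarrow> lessK K v u"
proof (cases u; cases v)
  fix a b assume "u = Fin a" "v = Fin b"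
  then show ?thesis by (simp add: lessK_Fin del: lessK.simps(1))
qed auto

text \<open>
  The weak supremum of a lower set, see \<open>WSup_eq_lower_sup\<close>.
\<close>

definition lower_sup :: "'y set \<Rightarrow> 'y extended set" where
  "lower_sup D = (if D = UNIV then {Pinf} else Fin ` edge D)"

lemma lower_sup_nonempty: "lower D \<Longrightarrow> lower_sup D \<noteq> {}"
  using edge_nonempty unfolding lower_sup_def by auto

lemma Fin_mem_lower_sup: "Fin y \<in> lower_sup D \<longleftrightarrow> D \<noteq> UNIV \<and> y \<in> edge D"
  unfolding lower_sup_def by auto

lemma WSup_eq_Pinf: "Pinf \<in> M \<Longrightarrow> WSup K M = {Pinf}"
proof (intro set_eqI iffI)
  fix w assume M: "Pinf \<in> M" and "w \<in> WSup K M"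
  then show "w \<in> {Pinf}" by (cases w) (auto simp: WSup_def)
next
  fix w assume M: "Pinf \<in> M" and "w \<in> {Pinf :: 'y extended}"
  then have w: "w = Pinf" by simp
  then show "w \<in> WSup K M" using M unfolding w WSup_def by auto
qed

text \<open>
  Elements \<open>Minf\<close> of \<open>M\<close> do not influence the weak supremum, because nothing lies below them.
  A finite element is needed, as \<open>WSup {Minf} = {Minf}\<close>.
\<close>

lemma WSup_eq_lower_sup:
  assumes M: "Pinf \<notin> M" and ne: "{y. Fin y \<in> M} \<noteq> {}"
  shows "WSup K M = lower_sup (down {y. Fin y \<in> M})"
proof -
  define D where "D = down {y. Fin y \<in> M}"
  obtain m where m: "Fin m \<in> M" using ne by blast
  have D: "lower D" unfolding D_def using lower_down[OF ne] .
  have less: "(\<exists>v\<in>M. lessK K (Fin y) v) \<longleftrightarrow> y \<in> D" for y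
  proof
    assume "\<exists>v\<in>M. lessK K (Fin y) v"
    then obtain v where v: "v \<in> M" "lessK K (Fin y) v" by blast
    then show "y \<in> D"
      using M by (cases v) (auto simp: D_def down_def lessK_Fin simp del: lessK.simps(1))
  next
    assume "y \<in> D"
    then show "\<exists>v\<in>M. lessK K (Fin y) v"
      unfolding D_def down_def using lessK_Fin by blast
  qed
  have Minf: "\<exists>v\<in>M. lessK K Minf v" using m by force
  have below: "(\<forall>u. lessK K u w \<longrightarrow> (\<exists>v\<in>M. lessK K u v)) \<longleftrightarrow> (\<forall>y. lessK K (Fin y) w \<longrightarrow> y \<in> D)" for w
  proof
    assume *: "\<forall>y. lessK K (Fin y) w \<longrightarrow> y \<in> D"
    show "\<forall>u. lessK K u w \<longrightarrow> (\<exists>v\<in>M. lessK K u v)"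
    proof (intro allI impI)
      fix u assume "lessK K u w"
      then show "\<exists>v\<in>M. lessK K u v" using * less Minf by (cases u) auto
    qed
  qed (use less in blast)
  have "w \<in> WSup K M \<longleftrightarrow> w \<in> lower_sup D" for w
  proof (cases w)
    case (Fin y)
    have "(\<forall>z. y - z \<in> interior K \<longrightarrow> z \<in> D) \<longleftrightarrow> (\<forall>k\<in>interior K. y - k \<in> D)"
      by (metis diff_diff_eq2 add_diff_cancel_left')
    then have "w \<in> WSup K M \<longleftrightarrow> y \<notin> D \<and> (\<forall>k\<in>interior K. y - k \<in> D)"
      unfolding WSup_def mem_Collect_eq below using less[of y] by (auto simp: Fin lessK_Fin simp del: lessK.simps(1))
    then show ?thesis using Fin by (auto simp: Fin_mem_lower_sup edge_def)
  next
    case Pinf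
    then show ?thesis unfolding WSup_def mem_Collect_eq below by (auto simp: lower_sup_def)
  next
    case w: Minf
    then have "w \<notin> WSup K M" using Minf unfolding WSup_def by blast
    then show ?thesis by (auto simp: w lower_sup_def)
  qed
  then show ?thesis unfolding D_def by blast
qed

lemma Fin_image_plus: "Fin ` U + Fin ` V = Fin ` (U + V)"
proof (intro equalityI subsetI)
  fix w assume "w \<in> Fin ` U + Fin ` V"
  then obtain u v where "w = Fin (u + v)" "u \<in> U" "v \<in> V" by (auto elim!: set_plus_elim)
  then show "w \<in> Fin ` (U + V)" by (auto intro: set_plus_intro)
next
  fix w assume "w \<in> Fin ` (U + V)"
  then obtain u v where "w = Fin u + Fin v" "u \<in> U" "v \<in> V" by (auto elim!: set_plus_elim)
  then show "w \<in> Fin ` U + Fin ` V" by (auto intro: set_plus_intro simp del: plus_extended.simps)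
qed

text \<open>
  If one of the two values is \<open>{Pinf}\<close>, then so is their WS-sum, in accordance with \<open>D + E = UNIV\<close>.
\<close>

lemma wsum_lower_sup:
  assumes D: "lower D" and E: "lower E"
  shows "wsum K (lower_sup D) (lower_sup E) = lower_sup (D + E)"
proof (cases "D = UNIV \<or> E = UNIV")
  case True
  then have "D + E = UNIV" using summands_not_UNIV[OF D E] by blast
  moreover have "Pinf \<in> lower_sup D + lower_sup E"
  proof -
    have *: "Pinf + w = Pinf" "w + Pinf = Pinf" for w :: "'y extended" by (cases w; simp)+
    have UNIV: "Pinf \<in> lower_sup UNIV" unfolding lower_sup_def by simp
    obtain v w where "v \<in> lower_sup D" "w \<in> lower_sup E" "v = Pinf \<or> w = Pinf"
      using True lower_sup_nonempty[OF D] lower_sup_nonempty[OF E] UNIV by blast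
    then show ?thesis using * by (metis set_plus_intro)
  qed
  ultimately show ?thesis by (simp add: wsum_def WSup_eq_Pinf lower_sup_def)
next
  case False
  have eq: "lower_sup D + lower_sup E = Fin ` (edge D + edge E)"
    using False by (simp add: lower_sup_def Fin_image_plus)
  have "wsum K (lower_sup D) (lower_sup E) = lower_sup (down {y. Fin y \<in> Fin ` (edge D + edge E)})"
    unfolding wsum_def eq
    using False edge_nonempty[OF D] edge_nonempty[OF E]
    by (intro WSup_eq_lower_sup) (auto simp: set_plus_def)
  also have "{y. Fin y \<in> Fin ` (edge D + edge E)} = edge D + edge E" by auto
  finally show ?thesis using down_edge_plus_edge D E False by simp
qed

lemma uminus_uminus_extended: "- (- w) = w" for w :: "'y extended"
  by (cases w) auto

lemma inj_uminus_extended: "inj (uminus :: 'y extended \<Rightarrow> 'y extended)"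
  by (rule inj_on_inverseI[of _ uminus]) (rule uminus_uminus_extended)

lemma WSup_uminus: "WSup K (uminus ` M) = uminus ` WInf K M"
proof -
  have swap: "lessK K u (- v) \<longleftrightarrow> lessK K v (- u)" for u v
    using lessK_uminus[of "- u" v] unfolding uminus_uminus_extended .
  have all: "(\<forall>u::'y extended. P u) \<longleftrightarrow> (\<forall>u. P (- u))" for P
    using uminus_uminus_extended by metis
  have "(\<forall>u. lessK K (- w) u \<longrightarrow> (\<exists>v\<in>M. lessK K v u)) \<longleftrightarrow>
      (\<forall>u. lessK K u w \<longrightarrow> (\<exists>v\<in>M. lessK K v (- u)))" for w
    by (subst all) (simp only: lessK_uminus)
  then have "w \<in> WSup K (uminus ` M) \<longleftrightarrow> - w \<in> WInf K M" for w
    unfolding WSup_def WInf_def by (simp add: swap)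
  moreover have "w \<in> uminus ` WInf K M \<longleftrightarrow> - w \<in> WInf K M" for w
    by (metis image_iff uminus_uminus_extended)
  ultimately show ?thesis by blast
qed

lemma WInf_eq_uminus_WSup: "WInf K M = uminus ` WSup K (uminus ` M)"
  unfolding WSup_uminus image_image by (simp add: uminus_uminus_extended)

section \<open>Conjugates and their epigraphs\<close>

definition conj_lower :: "('x \<Rightarrow> 'y extended) \<Rightarrow> ('x \<Rightarrow> 'y) \<Rightarrow> 'y set" where
  "conj_lower H L = down {L x - h | x h. H x = Fin h}"

lemma mem_conj_lower:
  "y \<in> conj_lower H L \<longleftrightarrow> (\<exists>x h. H x = Fin h \<and> L x - h - y \<in> interior K)"
  unfolding conj_lower_def down_def by blast

lemma proper_ext_Fin: "proper_ext H \<Longrightarrow> \<exists>x h. H x = Fin h"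
  unfolding proper_ext_def edom_def by (metis (mono_tags, lifting) extended.exhaust ex_in_conv mem_Collect_eq)

lemma lower_conj_lower: "proper_ext H \<Longrightarrow> lower (conj_lower H L)"
  unfolding conj_lower_def using proper_ext_Fin by (intro lower_down) blast

lemma WSup_minus_eq_conj_lower:
  assumes H: "proper_ext H" and D: "edom H \<subseteq> D"
  shows "WSup K {Fin (L x) - H x | x. x \<in> D} = lower_sup (conj_lower H L)"
proof -
  let ?M = "{Fin (L x) - H x | x. x \<in> D}"
  have "Pinf \<noteq> Fin (L x) - H x" for x
    using H unfolding proper_ext_def by (cases "H x") auto
  then have fin: "Pinf \<notin> ?M" by blast
  have M: "{y. Fin y \<in> ?M} = {L x - h | x h. H x = Fin h}"
  proof -
    have "Fin y = Fin (L x) - H x \<longleftrightarrow> (\<exists>h. H x = Fin h \<and> y = L x - h)" for x y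
      by (cases "H x") auto
    moreover have "x \<in> D" if "H x = Fin h" for x h
      using that D unfolding edom_def by auto
    ultimately show ?thesis by blast
  qed
  have "{L x - h | x h. H x = Fin h} \<noteq> {}" using proper_ext_Fin[OF H] by blast
  then show ?thesis
    unfolding conj_lower_def using WSup_eq_lower_sup[OF fin, unfolded M] by blast
qed

lemma conjugate_eq:
  assumes "proper_ext H"
  shows "conjugate K H L = lower_sup (conj_lower H L)"
  using WSup_minus_eq_conj_lower[OF assms, of UNIV L] unfolding conjugate_def by simp

lemma epi_conjugate_eq:
  fixes H :: "'x::locally_convex_space \<Rightarrow> 'y extended"
  assumes H: "proper_ext H"
  shows "epi_conjugate K H = {(L, y). L \<in> clin \<and> y \<notin> conj_lower H L}"
proof -
  have "Fin y \<in> conjugate K H L + Fin ` K \<longleftrightarrow> y \<notin> conj_lower H L" for L y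
  proof
    assume "Fin y \<in> conjugate K H L + Fin ` K"
    then obtain v k where vk: "v \<in> conjugate K H L" "k \<in> K" "Fin y = v + Fin k"
      by (auto elim!: set_plus_elim)
    then obtain u where u: "v = Fin u" "y = u + k" by (cases v) auto
    then have "u \<in> edge (conj_lower H L)"
      using vk by (simp add: conjugate_eq[OF H] Fin_mem_lower_sup)
    then show "y \<notin> conj_lower H L"
      using lower_below_K[OF lower_conj_lower[OF H], of y L u] vk u unfolding edge_def by auto
  next
    assume y: "y \<notin> conj_lower H L"
    then have "conj_lower H L \<noteq> UNIV" by blast
    then obtain u where u: "u \<in> edge (conj_lower H L)" "y - u \<in> K"
      using edge_below_K[OF lower_conj_lower[OF H] _ y] by blast
    then have "Fin u + Fin (y - u) \<in> conjugate K H L + Fin ` K"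
      using y by (intro set_plus_intro) (auto simp: conjugate_eq[OF H] Fin_mem_lower_sup)
    then show "Fin y \<in> conjugate K H L + Fin ` K" by simp
  qed
  then show ?thesis unfolding epi_conjugate_def by simp
qed

text \<open>
  The next four notions describe sets of pairs \<open>(L, U)\<close> through pairs \<open>(L, D)\<close> with \<open>D\<close> a lower set.
  An extended epigraph consists of the pairs \<open>(L, edge E)\<close> where \<open>E\<close> runs through the proper lower
  sets that contain the given \<open>D\<close>, and \<open>missed\<close> will be its image under \<open>Psi\<close>.
\<close>

definition enlarged_edges :: "(('x \<Rightarrow> 'y) \<times> 'y set) set \<Rightarrow> (('x \<Rightarrow> 'y) \<times> 'y set) set" where
  "enlarged_edges B = {(L, edge E) | L D E. (L, D) \<in> B \<and> D \<subseteq> E \<and> lower E \<and> E \<noteq> UNIV}"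

definition missed :: "(('x \<Rightarrow> 'y) \<times> 'y set) set \<Rightarrow> (('x \<Rightarrow> 'y) \<times> 'y) set" where
  "missed B = {(L, y). \<exists>D. (L, D) \<in> B \<and> y \<notin> D}"

definition conj_graph :: "('x::locally_convex_space \<Rightarrow> 'y extended) set \<Rightarrow> (('x \<Rightarrow> 'y) \<times> 'y set) set" where
  "conj_graph \<H> = {(L, conj_lower H L) | L H. L \<in> clin \<and> H \<in> \<H>}"

definition graph_plus ::
  "(('x \<Rightarrow> 'y) \<times> 'y set) set \<Rightarrow> (('x \<Rightarrow> 'y) \<times> 'y set) set \<Rightarrow> (('x \<Rightarrow> 'y) \<times> 'y set) set" where
  "graph_plus B1 B2 = {(\<lambda>x. L1 x + L2 x, D1 + D2) | L1 L2 D1 D2. (L1, D1) \<in> B1 \<and> (L2, D2) \<in> B2}"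

lemma mem_Psi: "(L, y) \<in> Psi M \<longleftrightarrow> (\<exists>U. (L, U) \<in> M \<and> y \<in> U)"
  unfolding Psi_def by auto

lemma mem_enlarged_edges:
  "(L, U) \<in> enlarged_edges B \<longleftrightarrow> (\<exists>D E. (L, D) \<in> B \<and> D \<subseteq> E \<and> lower E \<and> E \<noteq> UNIV \<and> U = edge E)"
  unfolding enlarged_edges_def by auto

lemma mem_missed: "(L, y) \<in> missed B \<longleftrightarrow> (\<exists>D. (L, D) \<in> B \<and> y \<notin> D)"
  unfolding missed_def by auto

lemma mem_conj_graph: "(L, D) \<in> conj_graph \<H> \<longleftrightarrow> L \<in> clin \<and> (\<exists>H\<in>\<H>. D = conj_lower H L)"
  unfolding conj_graph_def by auto

lemma mem_graph_plus:
  "(L, D) \<in> graph_plus B1 B2 \<longleftrightarrow>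
    (\<exists>L1 L2 D1 D2. L = (\<lambda>x. L1 x + L2 x) \<and> D = D1 + D2 \<and> (L1, D1) \<in> B1 \<and> (L2, D2) \<in> B2)"
  unfolding graph_plus_def by auto

lemma conj_graphI: "L \<in> clin \<Longrightarrow> H \<in> \<H> \<Longrightarrow> (L, conj_lower H L) \<in> conj_graph \<H>"
  unfolding mem_conj_graph by blast

lemma graph_plusI:
  "(L1, D1) \<in> B1 \<Longrightarrow> (L2, D2) \<in> B2 \<Longrightarrow> (\<lambda>x. L1 x + L2 x, D1 + D2) \<in> graph_plus B1 B2"
  unfolding mem_graph_plus by blast

text \<open>
  A relation \<open>\<preccurlyeq>\<close> between two frontiers says that no point of the second lies strictly below a
  point of the first, which means that the first lower set is contained in the second one.
\<close>

lemma Epi_conjugate_eq: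
  fixes H :: "'x::locally_convex_space \<Rightarrow> 'y extended"
  assumes H: "proper_ext H"
  shows "Epi_conjugate K H = enlarged_edges (conj_graph {H})"
proof -
  have iff: "conjugate K H L \<noteq> {Pinf} \<and> preceqK K (conjugate K H L) (Fin ` edge E) \<longleftrightarrow> conj_lower H L \<subseteq> E"
    if E: "lower E" "E \<noteq> UNIV" for L :: "'x \<Rightarrow> 'y" and E
  proof
    define D where "D = conj_lower H L"
    have D: "lower D" unfolding D_def by (rule lower_conj_lower[OF H])
    have conj: "conjugate K H L = lower_sup D" unfolding D_def by (rule conjugate_eq[OF H])
    {
      assume *: "conjugate K H L \<noteq> {Pinf} \<and> preceqK K (conjugate K H L) (Fin ` edge E)"
      then have DU: "D \<noteq> UNIV" unfolding conj lower_sup_def by auto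
      have no: "u - v \<notin> interior K" if "u \<in> edge D" "v \<in> edge E" for u v
        using * DU that unfolding conj lower_sup_def preceqK_def by (auto simp: lessK_Fin simp del: lessK.simps(1))
      show "conj_lower H L \<subseteq> E"
      proof (fold D_def, rule subsetI, rule ccontr)
        fix y assume y: "y \<in> D" "y \<notin> E"
        obtain v where v: "v \<in> edge E" "y - v \<in> K" using edge_below_K[OF E y(2)] by blast
        obtain u where u: "u \<in> edge D" "u - y \<in> interior K" using edge_above[OF D DU y(1)] by blast
        have "u - v \<in> interior K" using interior_add[OF u(2) v(2)] by simp
        then show False using no u v by blast
      qed
    next
      assume "conj_lower H L \<subseteq> E"
      then have sub: "D \<subseteq> E" and DU: "D \<noteq> UNIV" using E unfolding D_def by auto
      have "u - v \<notin> interior K" if "u \<in> edge D" "v \<in> edge E" for u v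
      proof
        assume "u - v \<in> interior K"
        then have "u - (u - v) \<in> D" using that unfolding edge_def by blast
        then show False using sub that unfolding edge_def by auto
      qed
      then show "conjugate K H L \<noteq> {Pinf} \<and> preceqK K (conjugate K H L) (Fin ` edge E)"
        using DU unfolding conj lower_sup_def preceqK_def by (auto simp: lessK_Fin simp del: lessK.simps(1))
    }
  qed
  show ?thesis
  proof (intro set_eqI iffI; clarify)
    fix L :: "'x \<Rightarrow> 'y" and U
    assume "(L, U) \<in> Epi_conjugate K H"
    then have "L \<in> clin" "conjugate K H L \<noteq> {Pinf}" "preceqK K (conjugate K H L) (Fin ` U)" "U \<in> Pp K"
      unfolding Epi_conjugate_def dom_conjugate_def by auto
    then show "(L, U) \<in> enlarged_edges (conj_graph {H})"
      unfolding Pp_iff mem_enlarged_edges mem_conj_graph using iff by blast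
  next
    fix L :: "'x \<Rightarrow> 'y" and U
    assume "(L, U) \<in> enlarged_edges (conj_graph {H})"
    then obtain E where "L \<in> clin" "conj_lower H L \<subseteq> E" "lower E" "E \<noteq> UNIV" "U = edge E"
      unfolding mem_enlarged_edges mem_conj_graph by blast
    then show "(L, U) \<in> Epi_conjugate K H"
      unfolding Epi_conjugate_def dom_conjugate_def using iff edge_in_Pp by blast
  qed
qed

lemma UN_Epi_conjugate_eq:
  fixes H :: "'i \<Rightarrow> 'x::locally_convex_space \<Rightarrow> 'y extended"
  assumes "\<And>i. i \<in> I \<Longrightarrow> proper_ext (H i)"
  shows "(\<Union>i\<in>I. Epi_conjugate K (H i)) = enlarged_edges (conj_graph (H ` I))"
proof -
  have "(\<Union>i\<in>I. Epi_conjugate K (H i)) = (\<Union>i\<in>I. enlarged_edges (conj_graph {H i}))"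
    by (intro SUP_cong refl Epi_conjugate_eq assms)
  also have "\<dots> = enlarged_edges (\<Union>i\<in>I. conj_graph {H i})"
  proof (rule set_eqI, clarify)
    fix L U
    show "(L, U) \<in> (\<Union>i\<in>I. enlarged_edges (conj_graph {H i})) \<longleftrightarrow>
        (L, U) \<in> enlarged_edges (\<Union>i\<in>I. conj_graph {H i})"
      unfolding UN_iff mem_enlarged_edges by blast
  qed
  also have "(\<Union>i\<in>I. conj_graph {H i}) = conj_graph (H ` I)"
    by (auto simp: mem_conj_graph)
  finally show ?thesis .
qed

text \<open>
  A point \<open>y\<close> outside \<open>D\<close> is on the frontier of the larger lower set \<open>D \<union> (y - interior K)\<close>.
\<close>

lemma Psi_enlarged_edges:
  assumes B: "\<And>L D. (L, D) \<in> B \<Longrightarrow> lower D"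
  shows "Psi (enlarged_edges B) = missed B"
proof (intro set_eqI iffI; clarify)
  fix L y assume "(L, y) \<in> Psi (enlarged_edges B)"
  then show "(L, y) \<in> missed B"
    unfolding mem_Psi mem_enlarged_edges mem_missed edge_def by auto
next
  fix L y assume "(L, y) \<in> missed B"
  then obtain D where D: "(L, D) \<in> B" "y \<notin> D" unfolding missed_def by blast
  define E where "E = D \<union> down {y}"
  have "y \<notin> E" using D zero_notin_interior unfolding E_def down_def by simp
  moreover have "lower E" unfolding E_def by (intro lower_Un lower_down B[OF D(1)]) simp
  moreover have "y \<in> edge E"
    using \<open>y \<notin> E\<close> unfolding edge_def E_def down_def by simp
  ultimately show "(L, y) \<in> Psi (enlarged_edges B)"
    using D unfolding mem_Psi mem_enlarged_edges E_def by blast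
qed

lemma boxplus_edges:
  assumes D: "lower D" "D \<noteq> UNIV" and E: "lower E" "E \<noteq> UNIV"
  shows "U \<in> Pp K \<and> Fin ` U = wsum K (Fin ` edge D) (Fin ` edge E) \<longleftrightarrow> D + E \<noteq> UNIV \<and> U = edge (D + E)"
proof -
  have "wsum K (Fin ` edge D) (Fin ` edge E) = lower_sup (D + E)"
    using wsum_lower_sup[OF D(1) E(1)] D E by (simp add: lower_sup_def)
  moreover have "Fin ` U = lower_sup (D + E) \<longleftrightarrow> D + E \<noteq> UNIV \<and> U = edge (D + E)"
    unfolding lower_sup_def by (auto simp: inj_image_eq_iff inj_on_def)
  ultimately show ?thesis using edge_in_Pp[OF lower_plus[OF D(1) E(1)]] by auto
qed

text \<open>
  In an iterated \<open>boxplus\<close> the left operand is itself a \<open>boxplus\<close>, and it need not contain the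
  frontier of every enlargement of \<open>D\<^sub>1 + D\<^sub>2\<close>, since an enlargement of a sum need not be a sum of
  enlargements.  It does contain the frontiers of the sums themselves, and this weaker property
  passes through \<open>boxplus\<close> and suffices for a left operand.
\<close>

definition edges_between ::
  "(('x \<Rightarrow> 'y) \<times> 'y set) set \<Rightarrow> (('x \<Rightarrow> 'y) \<times> 'y set) set \<Rightarrow> bool" where
  "edges_between B M \<longleftrightarrow>
     (\<forall>L D. (L, D) \<in> B \<longrightarrow> D \<noteq> UNIV \<longrightarrow> (L, edge D) \<in> M) \<and> M \<subseteq> enlarged_edges B"

lemma edges_between_enlarged_edges:
  "(\<And>L D. (L, D) \<in> B \<Longrightarrow> lower D) \<Longrightarrow> edges_between B (enlarged_edges B)"
  unfolding edges_between_def enlarged_edges_def by blast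

lemma lower_graph_plus:
  assumes "\<And>L D. (L, D) \<in> B1 \<Longrightarrow> lower D" "\<And>L D. (L, D) \<in> B2 \<Longrightarrow> lower D"
    and "(L, D) \<in> graph_plus B1 B2"
  shows "lower D"
  using assms lower_plus unfolding mem_graph_plus by blast

lemma boxplus_subset:
  assumes M1: "M1 \<subseteq> enlarged_edges B1" and M2: "M2 \<subseteq> enlarged_edges B2"
  shows "boxplus K M1 M2 \<subseteq> enlarged_edges (graph_plus B1 B2)"
proof
  fix q assume "q \<in> boxplus K M1 M2"
  then obtain L1 L2 U1 U2 U where q: "q = (\<lambda>x. L1 x + L2 x, U)" "(L1, U1) \<in> M1" "(L2, U2) \<in> M2"
      "U \<in> Pp K" "Fin ` U = wsum K (Fin ` U1) (Fin ` U2)"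
    unfolding boxplus_def by blast
  obtain D1 E1 where 1: "(L1, D1) \<in> B1" "D1 \<subseteq> E1" "lower E1" "E1 \<noteq> UNIV" "U1 = edge E1"
    using q M1 unfolding enlarged_edges_def by blast
  obtain D2 E2 where 2: "(L2, D2) \<in> B2" "D2 \<subseteq> E2" "lower E2" "E2 \<noteq> UNIV" "U2 = edge E2"
    using q M2 unfolding enlarged_edges_def by blast
  have "E1 + E2 \<noteq> UNIV" "U = edge (E1 + E2)"
    using q boxplus_edges[OF 1(3,4) 2(3,4), of U] 1 2 by auto
  moreover have "D1 + D2 \<subseteq> E1 + E2" using 1 2 by (intro set_plus_mono2)
  moreover have "(\<lambda>x. L1 x + L2 x, D1 + D2) \<in> graph_plus B1 B2"
    unfolding graph_plus_def using 1 2 by blast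
  ultimately show "q \<in> enlarged_edges (graph_plus B1 B2)"
    unfolding q enlarged_edges_def using lower_plus[OF 1(3) 2(3)] by blast
qed

lemma edge_mem_boxplus:
  assumes "(L1, edge D1) \<in> M1" "(L2, edge D2) \<in> M2" "lower D1" "lower D2" "D1 + D2 \<noteq> UNIV"
  shows "(\<lambda>x. L1 x + L2 x, edge (D1 + D2)) \<in> boxplus K M1 M2"
proof -
  note ne = summands_not_UNIV[OF assms(3-5)]
  have "edge (D1 + D2) \<in> Pp K \<and> Fin ` edge (D1 + D2) = wsum K (Fin ` edge D1) (Fin ` edge D2)"
    using boxplus_edges[OF assms(3) ne(1) assms(4) ne(2)] assms(5) by blast
  then show ?thesis unfolding boxplus_def using assms(1,2) by blast
qed

lemma edges_between_boxplus:
  assumes B: "\<And>L D. (L, D) \<in> B1 \<Longrightarrow> lower D" "\<And>L D. (L, D) \<in> B2 \<Longrightarrow> lower D"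
    and M: "edges_between B1 M1" "edges_between B2 M2"
  shows "edges_between (graph_plus B1 B2) (boxplus K M1 M2)"
  unfolding edges_between_def
proof (intro conjI allI impI)
  show "boxplus K M1 M2 \<subseteq> enlarged_edges (graph_plus B1 B2)"
    using boxplus_subset M unfolding edges_between_def by blast
next
  fix L D assume "(L, D) \<in> graph_plus B1 B2" and ne: "D \<noteq> UNIV"
  then obtain L1 L2 D1 D2 where q: "L = (\<lambda>x. L1 x + L2 x)" "D = D1 + D2" "(L1, D1) \<in> B1" "(L2, D2) \<in> B2"
    unfolding mem_graph_plus by blast
  then have "D1 \<noteq> UNIV" "D2 \<noteq> UNIV" using summands_not_UNIV[of D1 D2] B ne by blast+
  then show "(L, edge D) \<in> boxplus K M1 M2"
    unfolding q(1,2) using M q B ne unfolding edges_between_def by (intro edge_mem_boxplus) auto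
qed

text \<open>
  The largest set \<open>Z\<close> with \<open>y \<notin> D + Z\<close> is \<open>{z. y - z \<notin> D}\<close>; its points that lie strictly below
  another of its points form the required lower set.  That \<open>y\<close> cannot be lowered without entering
  the sum is seen by splitting \<open>y\<close> as \<open>u + (y - u)\<close> with \<open>u\<close> on the frontier of \<open>D\<close>.
\<close>

lemma enlarge_summand:
  assumes D: "lower D" and E: "lower E" and y: "y \<notin> D + E"
  obtains E' where "E \<subseteq> E'" "lower E'" "y \<in> edge (D + E')"
proof -
  define Z where "Z = {z. y - z \<notin> D}"
  have EZ: "E \<subseteq> Z"
  proof
    fix z assume "z \<in> E"
    then show "z \<in> Z" using y set_plus_intro[of "y - z" D z E] unfolding Z_def by auto
  qed
  then have Zne: "Z \<noteq> {}" using E unfolding lower_def by blast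
  have DU: "D \<noteq> UNIV" using Zne unfolding Z_def by blast
  have dZ: "down Z \<subseteq> Z"
  proof
    fix x assume "x \<in> down Z"
    then obtain z where z: "z \<in> Z" "z - x \<in> interior K" unfolding down_def by blast
    then show "x \<in> Z" using lower_below[OF D, of "y - x" "y - z"] unfolding Z_def by auto
  qed
  have "E \<subseteq> down Z"
  proof
    fix e assume "e \<in> E"
    then obtain k where "k \<in> interior K" "e + k \<in> E" using E unfolding lower_def by blast
    then have "e + k \<in> Z" "(e + k) - e \<in> interior K" using EZ by auto
    then show "e \<in> down Z" unfolding down_def by blast
  qed
  moreover have "lower (down Z)" by (rule lower_down[OF Zne])
  moreover have "y \<in> edge (D + down Z)"
    unfolding edge_def mem_Collect_eq
  proof (intro conjI ballI notI)
    assume "y \<in> D + down Z"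
    then obtain d z where "y = d + z" "d \<in> D" "z \<in> Z" using dZ by (auto elim!: set_plus_elim)
    then show False unfolding Z_def by simp
  next
    fix k assume k: "k \<in> interior K"
    let ?h = "(1/2) *\<^sub>R k"
    have h: "?h \<in> interior K" using k by (intro interior_scaleR) auto
    have hh: "?h + ?h = k" by (simp flip: scaleR_left.add)
    obtain u where u: "u \<in> edge D" using edge_nonempty[OF D DU] by blast
    have "u - ?h \<in> D" using u h unfolding edge_def by blast
    moreover have "y - u \<in> Z" using u unfolding Z_def edge_def by simp
    then have "y - u - ?h \<in> down Z" using h unfolding down_def by force
    ultimately have "(u - ?h) + (y - u - ?h) \<in> D + down Z" by (rule set_plus_intro)
    also have "(u - ?h) + (y - u - ?h) = y - (?h + ?h)" by (simp add: algebra_simps)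
    finally show "y - k \<in> D + down Z" unfolding hh .
  qed
  ultimately show thesis using that by blast
qed

text \<open>
  Only the right operand is enlarged, so the left one may be any set with \<open>edges_between\<close>.
\<close>

lemma Psi_boxplus:
  assumes B1: "\<And>L D. (L, D) \<in> B1 \<Longrightarrow> lower D" and B2: "\<And>L D. (L, D) \<in> B2 \<Longrightarrow> lower D"
    and M: "edges_between B1 M"
  shows "Psi (boxplus K M (enlarged_edges B2)) = missed (graph_plus B1 B2)"
proof
  have "boxplus K M (enlarged_edges B2) \<subseteq> enlarged_edges (graph_plus B1 B2)"
    using M by (intro boxplus_subset) (auto simp: edges_between_def)
  moreover have eq: "Psi (enlarged_edges (graph_plus B1 B2)) = missed (graph_plus B1 B2)"
    by (rule Psi_enlarged_edges) (rule lower_graph_plus[OF B1 B2])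
  ultimately have "Psi (boxplus K M (enlarged_edges B2)) \<subseteq> Psi (enlarged_edges (graph_plus B1 B2))"
    unfolding Psi_def by blast
  then show "Psi (boxplus K M (enlarged_edges B2)) \<subseteq> missed (graph_plus B1 B2)"
    using eq by simp
next
  show "missed (graph_plus B1 B2) \<subseteq> Psi (boxplus K M (enlarged_edges B2))"
  proof clarify
    fix L y assume "(L, y) \<in> missed (graph_plus B1 B2)"
    then obtain L1 L2 D1 D2 where q: "L = (\<lambda>x. L1 x + L2 x)" "(L1, D1) \<in> B1" "(L2, D2) \<in> B2" "y \<notin> D1 + D2"
      unfolding mem_missed mem_graph_plus by blast
    note D = B1[OF q(2)] B2[OF q(3)]
    obtain E where E: "D2 \<subseteq> E" "lower E" "y \<in> edge (D1 + E)"
      using enlarge_summand[OF D q(4)] by blast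
    have ne: "D1 + E \<noteq> UNIV" using E(3) unfolding edge_def by blast
    note ne' = summands_not_UNIV[OF D(1) E(2) ne]
    have "(L2, edge E) \<in> enlarged_edges B2"
      unfolding enlarged_edges_def using q E ne' by blast
    moreover have "(L1, edge D1) \<in> M" using M q ne' unfolding edges_between_def by blast
    ultimately have "(L, edge (D1 + E)) \<in> boxplus K M (enlarged_edges B2)"
      unfolding q(1) using D(1) E(2) ne by (intro edge_mem_boxplus)
    then show "(L, y) \<in> Psi (boxplus K M (enlarged_edges B2))" using E unfolding mem_Psi by blast
  qed
qed

lemma lower_conj_graph:
  "(\<And>H. H \<in> \<H> \<Longrightarrow> proper_ext H) \<Longrightarrow> (L, D) \<in> conj_graph \<H> \<Longrightarrow> lower D"
  unfolding mem_conj_graph using lower_conj_lower by blast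

section \<open>Strong duality as an intersection of lower sets\<close>

text \<open>
  Strong duality with attainment for one fixed linear perturbation, with all signs reversed:
  \<open>D\<close> stands for the primal problem and \<open>\<E>\<close> for the dual family, and the inclusions \<open>D \<subseteq> E\<close> are
  weak duality.  Both directions rest on the fact that, under \<open>D \<subseteq> E\<close>, a frontier point of \<open>D\<close> is
  outside \<open>E\<close> exactly if it is on the frontier of \<open>E\<close>.
\<close>

lemma lower_sup_attained_iff:
  assumes D: "lower D" and \<E>: "\<And>E. E \<in> \<E> \<Longrightarrow> lower E" "\<And>E. E \<in> \<E> \<Longrightarrow> D \<subseteq> E" "\<E> \<noteq> {}"
  shows "lower_sup D = (\<Union>E\<in>\<E>. lower_sup E) \<inter> WInf K (\<Union>E\<in>\<E>. lower_sup E) \<longleftrightarrow> D = \<Inter>\<E>"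
    (is "_ = ?N \<inter> _ \<longleftrightarrow> _")
proof
  assume eq: "lower_sup D = ?N \<inter> WInf K ?N"
  have "y \<notin> \<Inter>\<E>" if y: "y \<notin> D" for y
  proof -
    have DU: "D \<noteq> UNIV" using y by blast
    obtain u where u: "u \<in> edge D" "y - u \<in> K" using edge_below_K[OF D DU y] by blast
    then have "Fin u \<in> ?N" using eq DU Fin_mem_lower_sup by blast
    then obtain E where E: "E \<in> \<E>" "u \<in> edge E" using Fin_mem_lower_sup by blast
    then have "y \<notin> E" using lower_below_K[OF \<E>(1)[OF E(1)] _ u(2)] unfolding edge_def by blast
    then show ?thesis using E by blast
  qed
  then show "D = \<Inter>\<E>" using \<E> by blast
next
  assume eq: "D = \<Inter>\<E>"
  show "lower_sup D = ?N \<inter> WInf K ?N"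
  proof (cases "D = UNIV")
    case True
    then have "\<forall>E\<in>\<E>. E = UNIV" using \<E> by blast
    then have N: "?N = {Pinf}" using \<E>(3) unfolding lower_sup_def by auto
    have "Pinf \<in> WInf K {Pinf}" unfolding WInf_def by simp
    moreover have "lower_sup D = {Pinf}" using True unfolding lower_sup_def by simp
    ultimately show ?thesis unfolding N by simp
  next
    case False
    have sub: "Fin y \<in> ?N" if y: "y \<in> edge D" for y
    proof -
      obtain E where E: "E \<in> \<E>" "y \<notin> E" using y eq unfolding edge_def by blast
      then have "y \<in> edge E" using y \<E>(2)[OF E(1)] unfolding edge_def by blast
      then show ?thesis using E Fin_mem_lower_sup by blast
    qed
    have fin: "Fin y \<in> WInf K ?N" if y: "y \<in> edge D" for y
    proof -
      have "\<not> lessK K v (Fin y)" if v: "v \<in> ?N" for v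
      proof
        assume less: "lessK K v (Fin y)"
        obtain E where E: "E \<in> \<E>" "v \<in> lower_sup E" using v by blast
        have "v \<noteq> Pinf" "v \<noteq> Minf" using less E by (auto simp: lower_sup_def split: if_splits)
        then obtain z where z: "v = Fin z" by (cases v) auto
        then have "y - z \<in> interior K" "z \<in> edge E"
          using less E by (simp_all add: lessK_Fin Fin_mem_lower_sup del: lessK.simps(1))
        then have "y - (y - z) \<in> D" "z \<notin> E" using y unfolding edge_def by blast+
        then show False using \<E>(2)[OF E(1)] by auto
      qed
      then show ?thesis using sub[OF y] unfolding WInf_def by blast
    qed
    \<comment> \<open>An element of the weak infimum of the union cannot lie strictly above a frontier point of
      \<open>D\<close>, because these points belong to the union as well.\<close>
    have "w \<in> lower_sup D" if w: "w \<in> ?N" "w \<in> WInf K ?N" for w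
    proof -
      have nless: "\<not> lessK K (Fin u) w" if "u \<in> edge D" for u
        using w(2) sub[OF that] unfolding WInf_def by blast
      obtain u0 where "u0 \<in> edge D" using edge_nonempty[OF D False] by blast
      then have "w \<noteq> Pinf" using nless by force
      moreover obtain E where E: "E \<in> \<E>" "w \<in> lower_sup E" using w by blast
      then have "w \<noteq> Minf" by (auto simp: lower_sup_def split: if_splits)
      ultimately obtain y where y: "w = Fin y" by (cases w) auto
      then have yE: "y \<in> edge E" using E Fin_mem_lower_sup by blast
      then have yD: "y \<notin> D" using \<E>(2)[OF E(1)] unfolding edge_def by blast
      have "y \<in> edge D" using edge_below[OF D False yD] nless unfolding y lessK_Fin by blast
      then show ?thesis using False unfolding y Fin_mem_lower_sup by blast
    qed
    then have "?N \<inter> WInf K ?N \<subseteq> lower_sup D" by (intro subsetI) (elim IntE)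
    moreover have "lower_sup D = Fin ` edge D" using False unfolding lower_sup_def by simp
    then have "lower_sup D \<subseteq> ?N \<inter> WInf K ?N"
      by (simp only: image_subset_iff Int_iff) (intro ballI conjI sub fin)
    ultimately show ?thesis by (intro subset_antisym)
  qed
qed

section \<open>Weak duality and the dual families\<close>

lemma conj_lower_add_subset:
  assumes "proper_ext H1" "proper_ext H2"
  shows "conj_lower (\<lambda>x. H1 x + H2 x) (\<lambda>x. L1 x + L2 x) \<subseteq> conj_lower H1 L1 + conj_lower H2 L2"
proof
  fix y assume "y \<in> conj_lower (\<lambda>x. H1 x + H2 x) (\<lambda>x. L1 x + L2 x)"
  then obtain x h where h: "H1 x + H2 x = Fin h" "L1 x + L2 x - h - y \<in> interior K"
    unfolding mem_conj_lower by blast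
  obtain h1 h2 where hs: "H1 x = Fin h1" "H2 x = Fin h2" "h = h1 + h2"
    using h(1) by (cases "H1 x"; cases "H2 x") auto
  let ?k = "(1/2) *\<^sub>R (L1 x + L2 x - h - y)"
  have k: "?k \<in> interior K" using h by (intro interior_scaleR) auto
  have "?k + ?k = L1 x + L2 x - h - y" by (simp flip: scaleR_left.add)
  then have y: "y = (L1 x - h1 - ?k) + (L2 x - h2 - ?k)" by (simp add: hs algebra_simps)
  have "L1 x - h1 - ?k \<in> conj_lower H1 L1" "L2 x - h2 - ?k \<in> conj_lower H2 L2"
    unfolding conj_lower_def using hs k by (auto intro!: minus_mem_down)
  then show "y \<in> conj_lower H1 L1 + conj_lower H2 L2" by (subst y) (rule set_plus_intro)
qed

lemma conj_lower_diff_linear: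
  "conj_lower (\<lambda>x. F x - Fin (L x)) L' = conj_lower F (\<lambda>x. L x + L' x)"
proof -
  have "F x - Fin (L x) = Fin h \<longleftrightarrow> F x = Fin (h + L x)" for x h
    by (cases "F x") (auto simp: algebra_simps)
  then have "y \<in> conj_lower (\<lambda>x. F x - Fin (L x)) L' \<longleftrightarrow>
      (\<exists>x h. F x = Fin (h + L x) \<and> (L x + L' x) - (h + L x) - y \<in> interior K)" for y
    unfolding mem_conj_lower by (simp add: algebra_simps)
  moreover have "(\<exists>h. F x = Fin (h + L x) \<and> (L x + L' x) - (h + L x) - y \<in> interior K) \<longleftrightarrow>
      (\<exists>h. F x = Fin h \<and> L x + L' x - h - y \<in> interior K)" for x y
    by (metis diff_add_cancel)
  ultimately show ?thesis by (auto simp: mem_conj_lower)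
qed

lemma WInf_eq_conj_lower:
  assumes H: "proper_ext H" and D: "edom H \<subseteq> D"
  shows "WInf K {H x - Fin (L x) | x. x \<in> D} = uminus ` lower_sup (conj_lower H L)"
proof -
  have "- (H x - Fin (L x)) = Fin (L x) - H x" for x by (cases "H x") auto
  then have "uminus ` {H x - Fin (L x) | x. x \<in> D} = {Fin (L x) - H x | x. x \<in> D}"
    unfolding setcompr_eq_image image_image by simp
  then show ?thesis
    unfolding WInf_eq_uminus_WSup using WSup_minus_eq_conj_lower[OF assms] by simp
qed

lemma WMax_uminus: "WMax K (uminus ` M) = uminus ` (M \<inter> WInf K M)"
  unfolding WMax_def WSup_uminus by (simp add: image_Int inj_uminus_extended)

text \<open>
  The equivalence between epigraphs and stable strong duality for an abstract dual problem: \<open>B\<close>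
  collects the lower sets of the dual family, each paired with its linear perturbation \<open>L\<close>.
\<close>

lemma epi_conjugate_eq_missed_iff:
  fixes H :: "'x::locally_convex_space \<Rightarrow> 'y extended"
  assumes H: "proper_ext H"
    and B: "\<And>L D. (L, D) \<in> B \<Longrightarrow> lower D"
    and ne: "\<And>L. L \<in> clin \<Longrightarrow> \<exists>D. (L, D) \<in> B"
    and weak: "\<And>L D. (L, D) \<in> B \<Longrightarrow> L \<in> clin \<and> conj_lower H L \<subseteq> D"
    and N: "\<And>L. L \<in> clin \<Longrightarrow> N L = uminus ` (\<Union>D\<in>{D. (L, D) \<in> B}. lower_sup D)"
  shows "epi_conjugate K H = missed B \<longleftrightarrow>
    (\<forall>L\<in>clin. uminus ` lower_sup (conj_lower H L) = WMax K (N L))"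
proof -
  have clin: "L \<in> clin" if "(L, D) \<in> B" for L D using weak[OF that] by blast
  have "epi_conjugate K H = missed B \<longleftrightarrow>
      (\<forall>L y. L \<in> clin \<and> y \<notin> conj_lower H L \<longleftrightarrow> (\<exists>D. (L, D) \<in> B \<and> y \<notin> D))"
    by (simp add: set_eq_iff epi_conjugate_eq[OF H] mem_missed)
  also have "\<dots> \<longleftrightarrow> (\<forall>L\<in>clin. \<forall>y. y \<in> conj_lower H L \<longleftrightarrow> (\<forall>D. (L, D) \<in> B \<longrightarrow> y \<in> D))"
    unfolding Ball_def
  proof (intro all_cong1)
    fix L
    show "(\<forall>y. L \<in> clin \<and> y \<notin> conj_lower H L \<longleftrightarrow> (\<exists>D. (L, D) \<in> B \<and> y \<notin> D)) \<longleftrightarrow>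
        (L \<in> clin \<longrightarrow> (\<forall>y. y \<in> conj_lower H L \<longleftrightarrow> (\<forall>D. (L, D) \<in> B \<longrightarrow> y \<in> D)))"
      by (cases "L \<in> clin") (use clin in auto)
  qed
  also have "\<dots> \<longleftrightarrow> (\<forall>L\<in>clin. conj_lower H L = \<Inter>{D. (L, D) \<in> B})"
    by (simp add: set_eq_iff)
  also have "\<dots> \<longleftrightarrow> (\<forall>L\<in>clin. uminus ` lower_sup (conj_lower H L) = WMax K (N L))"
  proof (intro ball_cong refl)
    fix L :: "'x \<Rightarrow> 'y" assume L: "L \<in> clin"
    have "conj_lower H L = \<Inter>{D. (L, D) \<in> B} \<longleftrightarrow>
      lower_sup (conj_lower H L) = (\<Union>D\<in>{D. (L, D) \<in> B}. lower_sup D) \<inter> WInf K (\<Union>D\<in>{D. (L, D) \<in> B}. lower_sup D)"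
    proof (rule lower_sup_attained_iff[symmetric])
      show "lower (conj_lower H L)" by (rule lower_conj_lower[OF H])
      show "lower E" "conj_lower H L \<subseteq> E" if "E \<in> {D. (L, D) \<in> B}" for E
        using that B weak by simp_all
      show "{D. (L, D) \<in> B} \<noteq> {}" using ne[OF L] by simp
    qed
    then show "conj_lower H L = \<Inter>{D. (L, D) \<in> B} \<longleftrightarrow> uminus ` lower_sup (conj_lower H L) = WMax K (N L)"
      unfolding N[OF L] WMax_uminus inj_image_eq_iff[OF inj_uminus_extended] .
  qed
  finally show ?thesis .
qed

lemma clin_add: "L \<in> clin \<Longrightarrow> L' \<in> clin \<Longrightarrow> (\<lambda>x. L x + L' x) \<in> clin"
  for L L' :: "'x::locally_convex_space \<Rightarrow> 'z::locally_convex_space"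
  unfolding clin_def by (auto intro: linear_compose_add continuous_on_add)

lemma clin_uminus: "L \<in> clin \<Longrightarrow> (\<lambda>x. - L x) \<in> clin"
  for L :: "'x::locally_convex_space \<Rightarrow> 'z::locally_convex_space"
  unfolding clin_def by (auto intro: linear_compose_neg continuous_on_minus)

lemma clin_zero: "(\<lambda>x. 0) \<in> clin"
  unfolding clin_def by (auto intro: linear_zero)

lemma clin_diff: "L \<in> clin \<Longrightarrow> L' \<in> clin \<Longrightarrow> (\<lambda>x. L x - L' x) \<in> clin"
  for L L' :: "'x::locally_convex_space \<Rightarrow> 'z::locally_convex_space"
  using clin_add[OF _ clin_uminus, of L L'] by simp

lemma zero_in_Lplus: "(\<lambda>z. 0) \<in> Lplus S K"
  unfolding Lplus_def using clin_zero zero_mem by auto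

text \<open>
  Weak duality: at a feasible point \<open>G x = - s\<close> with \<open>s \<in> S\<close>, and \<open>- T (G x) = T s \<in> K\<close> only raises
  the value \<open>L x - F x\<close>.
\<close>

lemma conj_lower_feasible_subset:
  assumes T: "T \<in> Lplus S K"
  shows "conj_lower (\<lambda>x. F x + ind (feasible S C G) x) L
    \<subseteq> conj_lower (\<lambda>x. F x + ind C x + map_extended T (G x)) L"
proof
  fix y assume "y \<in> conj_lower (\<lambda>x. F x + ind (feasible S C G) x) L"
  then obtain x h where xh: "F x + ind (feasible S C G) x = Fin h" "L x - h - y \<in> interior K"
    unfolding mem_conj_lower by blast
  have x: "x \<in> feasible S C G" using xh(1) by (cases "F x") (auto simp: ind_def split: if_splits)
  then obtain s where s: "s \<in> S" "G x = Fin (- s)" "x \<in> C" unfolding feasible_def by auto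
  have Fx: "F x = Fin h" using xh(1) x by (cases "F x") (auto simp: ind_def)
  have "T (- s) = - T s" using T linear_neg unfolding Lplus_def clin_def by blast
  then have "F x + ind C x + map_extended T (G x) = Fin (h - T s)"
    using s Fx by (simp add: ind_def)
  moreover have "T s \<in> K" using T s unfolding Lplus_def by blast
  then have "(L x - h - y) + T s \<in> interior K" using xh(2) by (intro interior_add)
  then have "L x - (h - T s) - y \<in> interior K" by (simp add: algebra_simps)
  ultimately show "y \<in> conj_lower (\<lambda>x. F x + ind C x + map_extended T (G x)) L"
    unfolding mem_conj_lower by blast
qed

text \<open>
  The substitution \<open>L\<^sub>1 = L + L'\<close>, \<open>L\<^sub>2 = - L'\<close> matches the decompositions of \<open>L\<close> in the \<open>boxplus\<close> sum with
  the dual variable \<open>L'\<close>; the lemma after this one uses \<open>L\<^sub>1 = L + L'\<close>, \<open>L\<^sub>2 = L''\<close>, \<open>L\<^sub>3 = - L' - L''\<close>.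
\<close>

lemma conj_graph_plus_sections:
  assumes "L \<in> clin"
  shows "{D. (L, D) \<in> graph_plus (conj_graph \<H>1) (conj_graph \<H>2)} =
    {conj_lower H1 (\<lambda>x. L x + L' x) + conj_lower H2 (\<lambda>x. - L' x) | L' H1 H2. L' \<in> clin \<and> H1 \<in> \<H>1 \<and> H2 \<in> \<H>2}"
    (is "?A = ?B")
proof
  show "?A \<subseteq> ?B"
  proof
    fix D assume "D \<in> ?A"
    then obtain L1 L2 H1 H2 where *: "L = (\<lambda>x. L1 x + L2 x)" "L2 \<in> clin" "H1 \<in> \<H>1" "H2 \<in> \<H>2"
        "D = conj_lower H1 L1 + conj_lower H2 L2"
      unfolding mem_graph_plus mem_conj_graph by blast
    have D: "D = conj_lower H1 (\<lambda>x. L x + - L2 x) + conj_lower H2 (\<lambda>x. - (- L2 x))"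
      unfolding * by simp
    show "D \<in> ?B"
      unfolding mem_Collect_eq
      by (rule exI[of _ "\<lambda>x. - L2 x"], rule exI[of _ H1], rule exI[of _ H2])
        (intro conjI D clin_uminus *)
  qed
  show "?B \<subseteq> ?A"
  proof
    fix D assume "D \<in> ?B"
    then obtain L' H1 H2 where *: "L' \<in> clin" "H1 \<in> \<H>1" "H2 \<in> \<H>2"
        "D = conj_lower H1 (\<lambda>x. L x + L' x) + conj_lower H2 (\<lambda>x. - L' x)" by blast
    have "(\<lambda>x. (L x + L' x) + - L' x, D) \<in> graph_plus (conj_graph \<H>1) (conj_graph \<H>2)"
      unfolding *(4) by (intro graph_plusI conj_graphI clin_add clin_uminus assms *)
    then show "D \<in> ?A" by simp
  qed
qed

lemma conj_graph_plus_plus_sections: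
  assumes "L \<in> clin"
  shows "{D. (L, D) \<in> graph_plus (graph_plus (conj_graph \<H>1) (conj_graph \<H>2)) (conj_graph \<H>3)} =
    {conj_lower H1 (\<lambda>x. L x + L' x) + conj_lower H2 L'' + conj_lower H3 (\<lambda>x. - L' x - L'' x) | L' L'' H1 H2 H3.
      L' \<in> clin \<and> L'' \<in> clin \<and> H1 \<in> \<H>1 \<and> H2 \<in> \<H>2 \<and> H3 \<in> \<H>3}"
    (is "?A = ?B")
proof
  show "?A \<subseteq> ?B"
  proof
    fix D assume "D \<in> ?A"
    then obtain L1 L2 L3 H1 H2 H3 where *: "L = (\<lambda>x. L1 x + L2 x + L3 x)" "L1 \<in> clin" "L2 \<in> clin"
        "H1 \<in> \<H>1" "H2 \<in> \<H>2" "H3 \<in> \<H>3" "D = conj_lower H1 L1 + conj_lower H2 L2 + conj_lower H3 L3"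
      unfolding mem_graph_plus mem_conj_graph by blast
    have D: "D = conj_lower H1 (\<lambda>x. L x + (L1 x - L x)) + conj_lower H2 L2
        + conj_lower H3 (\<lambda>x. - (L1 x - L x) - L2 x)"
      unfolding * by (simp add: algebra_simps)
    show "D \<in> ?B"
      unfolding mem_Collect_eq
      by (rule exI[of _ "\<lambda>x. L1 x - L x"], rule exI[of _ L2], rule exI[of _ H1], rule exI[of _ H2], rule exI[of _ H3])
        (intro conjI D clin_diff assms *)
  qed
  show "?B \<subseteq> ?A"
  proof
    fix D assume "D \<in> ?B"
    then obtain L' L'' H1 H2 H3 where *: "L' \<in> clin" "L'' \<in> clin" "H1 \<in> \<H>1" "H2 \<in> \<H>2" "H3 \<in> \<H>3"
        "D = conj_lower H1 (\<lambda>x. L x + L' x) + conj_lower H2 L'' + conj_lower H3 (\<lambda>x. - L' x - L'' x)"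
      by blast
    have "(\<lambda>x. ((L x + L' x) + L'' x) + (- L' x - L'' x), D)
        \<in> graph_plus (graph_plus (conj_graph \<H>1) (conj_graph \<H>2)) (conj_graph \<H>3)"
      unfolding *(6) by (intro graph_plusI conj_graphI clin_add clin_diff clin_uminus assms *)
    then show "D \<in> ?A" by simp
  qed
qed

end

section \<open>Stable strong duality and epigraphs\<close>

theorem theorem6p1:
  fixes K :: "'y::locally_convex_space set"
    and S :: "'z::locally_convex_space set"
    and C :: "'x::locally_convex_space set"
    and F :: "'x \<Rightarrow> 'y extended"
    and G :: "'x \<Rightarrow> 'z extended"
    and A :: "'x set"
  assumes "convex_cone K" and "closed K" and "K \<noteq> UNIV" and "interior K \<noteq> {}"
    and "convex_cone S" and "closed S"
    and "proper_ext F" and "proper_ext G"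
    and "C \<noteq> {}"
    and "A = feasible S C G"
    and "A \<inter> edom F \<noteq> {}"
  shows "(epi_conjugate K (\<lambda>x. F x + ind A x) = calA1 K S C F G
            \<longleftrightarrow> stable_strong_duality K S C F G (N1 K S C F G))
       \<and> (epi_conjugate K (\<lambda>x. F x + ind A x) = calA2 K S C F G
            \<longleftrightarrow> stable_strong_duality K S C F G (N2 K S C F G))
       \<and> (epi_conjugate K (\<lambda>x. F x + ind A x) = calA3 K S C F G
            \<longleftrightarrow> stable_strong_duality K S C F G (N3 K S C F G))"
proof -
  interpret solid_cone K by unfold_locales fact+
  define FA where "FA = (\<lambda>x. F x + ind A x)"
  define GT where "GT = (\<lambda>T x. map_extended T (G x) :: 'y extended)"
  define CT where "CT = (\<lambda>T x. ind C x + map_extended T (G x) :: 'y extended)"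
  define FT where "FT = (\<lambda>T x. F x + ind C x + map_extended T (G x))"
  let ?\<T> = "Lplus S K"
  \<comment> \<open>One feasible point at which \<open>F\<close> is finite makes all the mappings below proper.\<close>
  obtain a f where a: "a \<in> A" "F a = Fin f"
    using assms(7,11) unfolding edom_def proper_ext_def
    by (metis (mono_tags, lifting) disjoint_iff extended.exhaust mem_Collect_eq)
  obtain g where g: "a \<in> C" "G a = Fin g" using a(1) unfolding assms(10) feasible_def by auto
  have FM: "F x \<noteq> Minf" and GM: "G x \<noteq> Minf" for x using assms(7,8) unfolding proper_ext_def by auto
  have GTM: "map_extended T (G x) \<noteq> Minf" for x and T :: "'z \<Rightarrow> 'y" using GM[of x] by (cases "G x") auto
  have proper: "proper_ext FA" "proper_ext (ind C :: 'x \<Rightarrow> 'y extended)" "proper_ext (GT T)" "proper_ext (CT T)" "proper_ext (FT T)"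
    for T
  proof -
    have "u + v \<noteq> Minf" if "u \<noteq> Minf" "v \<noteq> Minf" for u v :: "'y extended"
      using that by (cases u; cases v) auto
    moreover have "ind D x \<noteq> Minf" for D and x :: 'x unfolding ind_def by auto
    moreover have "FA a \<noteq> Pinf" "ind C a \<noteq> Pinf" "GT T a \<noteq> Pinf" "CT T a \<noteq> Pinf" "FT T a \<noteq> Pinf"
      using a g unfolding FA_def GT_def CT_def FT_def ind_def by auto
    ultimately show "proper_ext FA" "proper_ext (ind C :: 'x \<Rightarrow> 'y extended)" "proper_ext (GT T)" "proper_ext (CT T)" "proper_ext (FT T)"
      using FM GTM unfolding proper_ext_def edom_def FA_def GT_def CT_def FT_def by blast+
  qed
  have ed: "edom FA \<subseteq> A" "edom (FT T) \<subseteq> C" for T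
  proof -
    have "Pinf + v = Pinf" "v + Pinf = Pinf" for v :: "'y extended" by (cases v; simp)+
    then show "edom FA \<subseteq> A" "edom (FT T) \<subseteq> C"
      unfolding edom_def FA_def FT_def ind_def by auto
  qed
  have primal: "WInf K {F x - Fin (L x) | x. x \<in> C \<and> G x \<in> Fin ` uminus ` S}
      = uminus ` lower_sup (conj_lower FA L)" for L
  proof -
    have feas: "x \<in> A \<longleftrightarrow> x \<in> C \<and> G x \<in> Fin ` uminus ` S" for x
      unfolding assms(10) feasible_def by simp
    have "F x - Fin (L x) = FA x - Fin (L x)" if "x \<in> A" for x
      using that unfolding FA_def ind_def by (cases "F x") auto
    then have "{F x - Fin (L x) | x. x \<in> C \<and> G x \<in> Fin ` uminus ` S} = {FA x - Fin (L x) | x. x \<in> A}"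
      unfolding feas[symmetric] setcompr_eq_image by (intro image_cong refl) simp
    then show ?thesis using WInf_eq_conj_lower[OF proper(1) ed(1)] by simp
  qed
  have duality: "epi_conjugate K FA = missed B \<longleftrightarrow> stable_strong_duality K S C F G N"
    if "\<And>L D. (L, D) \<in> B \<Longrightarrow> lower D" "\<And>L. L \<in> clin \<Longrightarrow> \<exists>D. (L, D) \<in> B"
      "\<And>L D. (L, D) \<in> B \<Longrightarrow> L \<in> clin \<and> conj_lower FA L \<subseteq> D"
      "\<And>L. L \<in> clin \<Longrightarrow> N L = uminus ` (\<Union>D\<in>{D. (L, D) \<in> B}. lower_sup D)" for B N
    unfolding stable_strong_duality_def primal
    by (rule epi_conjugate_eq_missed_iff[OF proper(1) that])
  have FL: "conjugate K (\<lambda>x. F x - Fin (L x)) L' = lower_sup (conj_lower F (\<lambda>x. L x + L' x))" for L L'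
  proof -
    have "F x - Fin (L x) \<noteq> Minf" for x using FM[of x] by (cases "F x") auto
    moreover have "F a - Fin (L a) \<noteq> Pinf" using a by simp
    ultimately have "proper_ext (\<lambda>x. F x - Fin (L x))" unfolding proper_ext_def edom_def by blast
    then show ?thesis by (simp add: conjugate_eq conj_lower_diff_linear)
  qed
  have CTL: "conjugate K (\<lambda>x. ind C x + map_extended T (G x)) L = lower_sup (conj_lower (CT T) L)" for T L
    using conjugate_eq[OF proper(4), of T L] unfolding CT_def .
  have GTL: "conjugate K (\<lambda>x. map_extended T (G x)) L = lower_sup (conj_lower (GT T) L)" for T L
    using conjugate_eq[OF proper(3), of T L] unfolding GT_def .
  have weak1: "conj_lower FA L \<subseteq> conj_lower (FT T) L" if "T \<in> ?\<T>" for T L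
    using conj_lower_feasible_subset[OF that, of F C G L] unfolding FA_def FT_def assms(10) .
  have weak2: "conj_lower FA (\<lambda>x. L1 x + L2 x) \<subseteq> conj_lower F L1 + conj_lower (CT T) L2"
    if "T \<in> ?\<T>" for T L1 L2
  proof -
    have "FT T = (\<lambda>x. F x + CT T x)" unfolding FT_def CT_def by (simp add: add.assoc)
    then show ?thesis
      using weak1[OF that] conj_lower_add_subset[OF assms(7) proper(4)] by (metis subset_trans)
  qed
  have weak3: "conj_lower FA (\<lambda>x. L1 x + L2 x + L3 x)
      \<subseteq> conj_lower F L1 + conj_lower (ind C) L2 + conj_lower (GT T) L3" if "T \<in> ?\<T>" for T L1 L2 L3
  proof -
    have "conj_lower FA (\<lambda>x. L1 x + (L2 x + L3 x)) \<subseteq> conj_lower F L1 + conj_lower (CT T) (\<lambda>x. L2 x + L3 x)"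
      by (rule weak2[OF that])
    also have "\<dots> \<subseteq> conj_lower F L1 + (conj_lower (ind C) L2 + conj_lower (GT T) L3)"
      using conj_lower_add_subset[OF proper(2) proper(3)] unfolding CT_def GT_def
      by (intro set_plus_mono2 subset_refl)
    finally show ?thesis by (simp add: add.assoc)
  qed

  have 1: "epi_conjugate K FA = calA1 K S C F G \<longleftrightarrow> stable_strong_duality K S C F G (N1 K S C F G)"
  proof -
    let ?B = "conj_graph (FT ` ?\<T>)"
    have B: "lower D" if "(L, D) \<in> ?B" for L D
      using that by (rule lower_conj_graph[rotated]) (auto simp: proper)
    have "calA1 K S C F G = Psi (\<Union>T\<in>?\<T>. Epi_conjugate K (FT T))"
      unfolding calA1_def FT_def ..
    also have "\<dots> = missed ?B"
      unfolding UN_Epi_conjugate_eq[OF proper(5)] by (intro Psi_enlarged_edges B)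
    finally have "calA1 K S C F G = missed ?B" .
    moreover have "epi_conjugate K FA = missed ?B \<longleftrightarrow> stable_strong_duality K S C F G (N1 K S C F G)"
    proof (rule duality[OF B])
      show "\<exists>D. (L, D) \<in> ?B" if "L \<in> clin" for L
        unfolding mem_conj_graph using that zero_in_Lplus by blast
      show "L \<in> clin \<and> conj_lower FA L \<subseteq> D" if "(L, D) \<in> ?B" for L D
        using that weak1 unfolding mem_conj_graph by blast
      fix L :: "'x \<Rightarrow> 'y" assume "L \<in> clin"
      then have sec: "{D. (L, D) \<in> ?B} = (\<lambda>T. conj_lower (FT T) L) ` ?\<T>" unfolding mem_conj_graph by blast
      have "{F x - Fin (L x) + map_extended T (G x) | x. x \<in> C} = {FT T x - Fin (L x) | x. x \<in> C}" for T
      proof -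
        have "F x - Fin (L x) + map_extended T (G x) = FT T x - Fin (L x)" if "x \<in> C" for x
          using that unfolding FT_def ind_def by (cases "F x"; cases "G x") auto
        then show ?thesis unfolding setcompr_eq_image by (intro image_cong refl) simp
      qed
      then have "N1 K S C F G L = (\<Union>T\<in>?\<T>. uminus ` lower_sup (conj_lower (FT T) L))"
        unfolding N1_def by (simp add: WInf_eq_conj_lower[OF proper(5) ed(2)])
      then show "N1 K S C F G L = uminus ` (\<Union>D\<in>{D. (L, D) \<in> ?B}. lower_sup D)"
        unfolding sec by blast
    qed
    ultimately show ?thesis by simp
  qed

  have lowers: "lower (conj_lower F L)" "lower (conj_lower (ind C) L)" "lower (conj_lower (GT T) L)"
      "lower (conj_lower (CT T) L)" for L :: "'x \<Rightarrow> 'y" and T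
    using proper assms(7) by (intro lower_conj_lower; simp)+
  have lgF: "lower D" if "(L, D) \<in> conj_graph {F}" for L D
    using that lowers unfolding mem_conj_graph by blast
  have lgC: "lower D" if "(L, D) \<in> conj_graph {ind C}" for L D
    using that lowers unfolding mem_conj_graph by blast
  have lgCT: "lower D" if "(L, D) \<in> conj_graph (CT ` ?\<T>)" for L D
    using that lowers unfolding mem_conj_graph by blast
  have lgGT: "lower D" if "(L, D) \<in> conj_graph (GT ` ?\<T>)" for L D
    using that lowers unfolding mem_conj_graph by blast

  have 2: "epi_conjugate K FA = calA2 K S C F G \<longleftrightarrow> stable_strong_duality K S C F G (N2 K S C F G)"
  proof -
    let ?B = "graph_plus (conj_graph {F}) (conj_graph (CT ` ?\<T>))"
    have "calA2 K S C F G = Psi (boxplus K (Epi_conjugate K F) (\<Union>T\<in>?\<T>. Epi_conjugate K (CT T)))"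
      unfolding calA2_def CT_def ..
    also have "\<dots> = missed ?B"
      unfolding UN_Epi_conjugate_eq[OF proper(4)] Epi_conjugate_eq[OF assms(7)]
      by (intro Psi_boxplus edges_between_enlarged_edges lgF lgCT)
    finally have "calA2 K S C F G = missed ?B" .
    moreover have "epi_conjugate K FA = missed ?B \<longleftrightarrow> stable_strong_duality K S C F G (N2 K S C F G)"
    proof (rule duality)
      show "lower D" if "(L, D) \<in> ?B" for L D
        using lower_graph_plus[OF lgF lgCT that] .
      show "\<exists>D. (L, D) \<in> ?B" if "L \<in> clin" for L
      proof -
        have "(\<lambda>x. L x + 0, conj_lower F L + conj_lower (CT (\<lambda>z. 0)) (\<lambda>x. 0)) \<in> ?B"
          by (intro graph_plusI conj_graphI that clin_zero imageI zero_in_Lplus singletonI)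
        then show ?thesis by auto
      qed
      show "L \<in> clin \<and> conj_lower FA L \<subseteq> D" if LD: "(L, D) \<in> ?B" for L D
      proof -
        obtain L1 L2 T where *: "L = (\<lambda>x. L1 x + L2 x)" "D = conj_lower F L1 + conj_lower (CT T) L2"
            "L1 \<in> clin" "L2 \<in> clin" "T \<in> ?\<T>"
          using LD unfolding mem_graph_plus mem_conj_graph by blast
        show ?thesis unfolding *(1,2) by (intro conjI weak2 clin_add *)
      qed
      fix L :: "'x \<Rightarrow> 'y" assume L: "L \<in> clin"
      have "N2 K S C F G L = (\<Union>L'\<in>clin. \<Union>T\<in>?\<T>.
          uminus ` lower_sup (conj_lower F (\<lambda>x. L x + L' x) + conj_lower (CT T) (\<lambda>x. - L' x)))"
        unfolding N2_def FL CTL by (simp add: wsum_lower_sup lowers)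
      also have "\<dots> = uminus ` (\<Union>D\<in>{D. (L, D) \<in> ?B}. lower_sup D)"
        unfolding conj_graph_plus_sections[OF L] by blast
      finally show "N2 K S C F G L = uminus ` (\<Union>D\<in>{D. (L, D) \<in> ?B}. lower_sup D)" .
    qed
    ultimately show ?thesis by simp
  qed

  have 3: "epi_conjugate K FA = calA3 K S C F G \<longleftrightarrow> stable_strong_duality K S C F G (N3 K S C F G)"
  proof -
    let ?B2 = "graph_plus (conj_graph {F}) (conj_graph {ind C})"
    let ?B = "graph_plus ?B2 (conj_graph (GT ` ?\<T>))"
    have "calA3 K S C F G = Psi (boxplus K (boxplus K (Epi_conjugate K F) (Epi_conjugate K (ind C)))
        (\<Union>T\<in>?\<T>. Epi_conjugate K (GT T)))"
      unfolding calA3_def GT_def ..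
    also have "\<dots> = missed ?B"
      unfolding UN_Epi_conjugate_eq[OF proper(3)] Epi_conjugate_eq[OF assms(7)] Epi_conjugate_eq[OF proper(2)]
      by (intro Psi_boxplus edges_between_boxplus edges_between_enlarged_edges lower_graph_plus[OF lgF lgC] lgF lgC lgGT)
    finally have "calA3 K S C F G = missed ?B" .
    moreover have "epi_conjugate K FA = missed ?B \<longleftrightarrow> stable_strong_duality K S C F G (N3 K S C F G)"
    proof (rule duality)
      show "lower D" if "(L, D) \<in> ?B" for L D
        by (rule lower_graph_plus[OF _ _ that]) (rule lower_graph_plus[OF lgF lgC] lgGT; assumption)+
      show "\<exists>D. (L, D) \<in> ?B" if "L \<in> clin" for L
      proof -
        have "(\<lambda>x. L x + 0 + 0, conj_lower F L + conj_lower (ind C) (\<lambda>x. 0)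
            + conj_lower (GT (\<lambda>z. 0)) (\<lambda>x. 0)) \<in> ?B"
          by (intro graph_plusI conj_graphI that clin_zero imageI zero_in_Lplus singletonI)
        then show ?thesis by auto
      qed
      show "L \<in> clin \<and> conj_lower FA L \<subseteq> D" if LD: "(L, D) \<in> ?B" for L D
      proof -
        obtain L1 L2 L3 T where *: "L = (\<lambda>x. L1 x + L2 x + L3 x)"
            "D = conj_lower F L1 + conj_lower (ind C) L2 + conj_lower (GT T) L3"
            "L1 \<in> clin" "L2 \<in> clin" "L3 \<in> clin" "T \<in> ?\<T>"
          using LD unfolding mem_graph_plus mem_conj_graph by blast
        show ?thesis unfolding *(1,2) by (intro conjI weak3 clin_add *)
      qed
      fix L :: "'x \<Rightarrow> 'y" assume L: "L \<in> clin"
      have "N3 K S C F G L = (\<Union>L'\<in>clin. \<Union>L''\<in>clin. \<Union>T\<in>?\<T>. uminus ` lower_sup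
          (conj_lower F (\<lambda>x. L x + L' x) + conj_lower (ind C) L'' + conj_lower (GT T) (\<lambda>x. - L' x - L'' x)))"
        unfolding N3_def FL GTL conjugate_eq[OF proper(2)]
        by (simp add: wsum_lower_sup lowers lower_plus)
      also have "\<dots> = uminus ` (\<Union>D\<in>{D. (L, D) \<in> ?B}. lower_sup D)"
        unfolding conj_graph_plus_plus_sections[OF L] by blast
      finally show "N3 K S C F G L = uminus ` (\<Union>D\<in>{D. (L, D) \<in> ?B}. lower_sup D)" .
    qed
    ultimately show ?thesis by simp
  qed
  show ?thesis using 1 2 3 unfolding FA_def by blast
qed

end
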